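(* Given constants $A\ge 1$, $D>0$, $m>0$, the following holds. Let $\mathcal{F}$ be a family of bi-Lipschitz functions $f:\mathbb{R}\to\mathbb{R}$ with constants $(c_1(f),c_2(f))$ such that $\frac{c_2(f)}{c_1(f)}\le A$ and $(c_1(f))^{-1}\le D$ for all $f\in\mathcal{F}$, and such that there exists a closed interval $I$ of length $m>0$ contained in $\bigcap_{f\in\mathcal{F}}f^{-1}([0,1])$. Let $$N(\tau):=\left\lfloor \frac{\tau\beta}{720^2\, e\, A^{1-\frac{1}{\log(\tau\beta)}}}\left(1-\beta^{\frac{1}{\log(\tau\beta)}}\right)\right\rfloor ,\qquad\text{where } \beta:=\min\left\{\frac{m}{D},\frac{1}{4A}\right\}.$$ Let $C\subset\mathbb{R}$ be a compact set with $\mathrm{conv}(C)=[0,1]$ and let $S=(-\infty,0)\cup C\cup(1,\infty)$. Then for any family $\mathcal{F}_0\subset\mathcal{F}$ with at most $N(\tau(C))$ elements, where $\tau(C)$ is the thickness of $C$, $$\dim_{\rm H}\left(I\cap\bigcap_{f\in\mathcal{F}_0}f^{-1}(S)\right)>0 .$$ In particular, since $S\cap f(I)\subset S\cap[0,1]\subset C$ for all $f\in\mathcal{F}$, the set $C$ contains every pattern in the family $\mathcal{F}$ with at most $N(\tau(C))$ elements, and in fact each such pattern $(f)_{f\in\mathcal{F}_0}$ is obtained for a set of $t$ of positive Hausdorff dimension (that is, the set of $t\in\mathbb{R}$ with $f(t)\in C$ for all $f\in\mathcal{F}_0$ has positive Hausdorff dimension). When $\tau$ is large enough, we also have that $N(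\tau)\sim\frac{\tau}{\log(\tau)}$.
   Context: $\mathrm{conv}(C)$ is the convex hull of $C$, $\dim_{\rm H}$ is Hausdorff dimension, $\log$ is the natural logarithm. $X\lesssim Y$ means that there is a positive constant $K$ with $X\le KY$, and $X\sim Y$ means $X\lesssim Y$ and $Y\lesssim X$ simultaneously (comparability up to positive constants). A function $f:\mathbb{R}\to\mathbb{R}$ is bi-Lipschitz with constants $(c_1,c_2)$, $0<c_1\le c_2<\infty$, if $c_1|x-y|\le|f(x)-f(y)|\le c_2|x-y|$ for all $x,y\in\mathbb{R}$. A set $E\subset\mathbb{R}$ contains the pattern $(f_i)_{i\in\Lambda}$ (where $f_i:\mathbb{R}\to\mathbb{R}$) if there exists $t\in\mathbb{R}$ with $f_i(t)\in E$ for all $i\in\Lambda$, equivalently $\bigcap_{i\in\Lambda}f_i^{-1}(E)\neq\emptyset$. Thickness: let $C\subset\mathbb{R}$ be a compact set with convex hull $J$. Let $(G_n)_n$ be the (finitely or countably many) disjoint open intervals making up $J\setminus C$, ordered by decreasing length (ties ordered arbitrarily; this does not affect the value below). $G_{n}$ is a subset of a connected component $I_{n}$ (a closed interval) of $J\setminus(G_1\cup\cdots\cup G_{n-1})$, and $I_n\setminus G_n$ consists of two closed intervals, the left piece $L_n$ and the right piece $R_n$. The thickness of $C$ is $$\tau(C):=\inf_n \frac{\min\{|L_n|,|R_n|\}}{|G_n|},$$ where $|\cdot|$ denotes length and the infimum is over the (possibly finite) set of indices. The thickness of a singleton is defined to be $0$, and the thickness of a non-degenerate interval is defined to be $+\i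nfty$.
   Formalization: The claims about F_0 are proved only when τ(C)β is not strictly between 1 and e: there N can blow up and the claim fails (e.g. A=2, D=1, m=1/8, central Cantor set with τ=8.16, three translations); N(∞) is read as ∞. *)

theory Defs
  imports "HOL-Analysis.Analysis"
begin

section \<open>Hausdorff dimension\<close>

text \<open>The boundedness condition is needed because \<^const>\<open>diameter\<close> is a junk value on
  unbounded sets.  Empty sets are allowed in a cover and contribute \<open>0 powr s = 0\<close>, so finite
  covers are included.  Only exponents \<open>s > 0\<close> are used below, so the convention for
  \<open>0 powr 0\<close> is irrelevant.\<close>

definition hausdorff_premeasure :: "real \<Rightarrow> real \<Rightarrow> 'a::metric_space set \<Rightarrow> ennreal" where
  "hausdorff_premeasure s \<delta> E =
     (INF U \<in> {U :: nat \<Rightarrow> 'a set. E \<subseteq> (\<Union>i. U i) \<and> (\<forall>i. bounded (U i) \<and> diameter (U i) \<le> \<delta>)}.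
        (\<Sum>i. ennreal (diameter (U i) powr s)))"

definition hausdorff_measure :: "real \<Rightarrow> 'a::metric_space set \<Rightarrow> ennreal" where
  "hausdorff_measure s E = (SUP \<delta> \<in> {0<..}. hausdorff_premeasure s \<delta> E)"

definition hausdorff_dim :: "'a::metric_space set \<Rightarrow> ereal" where
  "hausdorff_dim E = Inf {ereal s | s. 0 < s \<and> hausdorff_measure s E = 0}"

section \<open>Thickness of a compact subset of the line\<close>

definition gaps :: "real set \<Rightarrow> real set set" where
  "gaps C = components (convex hull C - C)"

abbreviation len :: "real set \<Rightarrow> real" where
  "len X \<equiv> measure lborel X"

text \<open>\<open>K\<close> is the index set, either all naturals or a finite (possibly empty) initial segment;
  indices start at \<open>0\<close>.\<close>

definition gap_enumeration :: "real set \<Rightarrow> nat set \<Rightarrow> (nat \<Rightarrow> real set) \<Rightarrow> bool" where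
  "gap_enumeration C K G \<longleftrightarrow>
     (K = UNIV \<or> (\<exists>k. K = {..<k})) \<and> bij_betw G K (gaps C) \<and>
     (\<forall>i\<in>K. \<forall>j\<in>K. i \<le> j \<longrightarrow> len (G j) \<le> len (G i))"

definition gap_parent :: "real set \<Rightarrow> (nat \<Rightarrow> real set) \<Rightarrow> nat \<Rightarrow> real set" where
  "gap_parent C G n =
     (THE I. I \<in> components (convex hull C - (\<Union>i<n. G i)) \<and> G n \<subseteq> I)"

definition left_piece :: "real set \<Rightarrow> (nat \<Rightarrow> real set) \<Rightarrow> nat \<Rightarrow> real set" where
  "left_piece C G n = {x \<in> gap_parent C G n - G n. \<forall>y\<in>G n. x < y}"

definition right_piece :: "real set \<Rightarrow> (nat \<Rightarrow> real set) \<Rightarrow> nat \<Rightarrow> real set" where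
  "right_piece C G n = {x \<in> gap_parent C G n - G n. \<forall>y\<in>G n. y < x}"

definition thickness_along :: "real set \<Rightarrow> nat set \<Rightarrow> (nat \<Rightarrow> real set) \<Rightarrow> ereal" where
  "thickness_along C K G =
     (INF n\<in>K. ereal (min (len (left_piece C G n)) (len (right_piece C G n)) / len (G n)))"

text \<open>The choice of enumeration only concerns ties between gaps of equal length and does not
  affect the value.  A nondegenerate compact interval has no gaps, so its thickness is the infimum
  of the empty set, i.e. \<open>\<infinity>\<close>.\<close>

definition thickness :: "real set \<Rightarrow> ereal" where
  "thickness C =
     (if \<exists>x. C = {x} then 0
      else (case (SOME KG. gap_enumeration C (fst KG) (snd KG)) of (K, G) \<Rightarrow> thickness_along C K G))"

section \<open>Bi-Lipschitz functions and patterns\<close>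

definition bi_lipschitz :: "(real \<Rightarrow> real) \<Rightarrow> real \<Rightarrow> real \<Rightarrow> bool" where
  "bi_lipschitz f c1 c2 \<longleftrightarrow>
     0 < c1 \<and> c1 \<le> c2 \<and> (\<forall>x y. c1 * \<bar>x - y\<bar> \<le> \<bar>f x - f y\<bar> \<and> \<bar>f x - f y\<bar> \<le> c2 * \<bar>x - y\<bar>)"

definition contains_pattern :: "real set \<Rightarrow> (real \<Rightarrow> real) set \<Rightarrow> bool" where
  "contains_pattern E P \<longleftrightarrow> (\<exists>t. \<forall>f\<in>P. f t \<in> E)"

definition pattern_beta :: "real \<Rightarrow> real \<Rightarrow> real \<Rightarrow> real" where
  "pattern_beta A D m = min (m / D) (1 / (4 * A))"

text \<open>With \<open>c = 1 - 1 / ln (\<tau> * \<beta>)\<close>, the quantity under the floor is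
  \<open>(\<tau> * \<beta> / A) powr c * (1 - \<beta> powr (1 - c)) / 720\<^sup>2\<close>.  It is a meaningful bound only if
  \<open>c \<ge> 0\<close>: for \<open>1 < \<tau> * \<beta> < exp 1\<close> we have \<open>c < 0\<close> and, when \<open>A > 1\<close>, the value blows up as
  \<open>\<tau> * \<beta>\<close> decreases to \<open>1\<close>.  For \<open>\<tau> * \<beta> \<le> 1\<close> the value is at most \<open>0\<close>
  (using \<open>ln 0 = 0\<close> and \<open>1 / 0 = 0\<close> for \<open>\<tau> * \<beta> = 0\<close> and \<open>\<tau> * \<beta> = 1\<close>).\<close>

definition pattern_bound :: "real \<Rightarrow> real \<Rightarrow> real \<Rightarrow> real \<Rightarrow> int" where
  "pattern_bound A D m \<tau> =
     (let \<beta> = pattern_beta A D m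
      in \<lfloor>\<tau> * \<beta> / (720\<^sup>2 * exp 1 * A powr (1 - 1 / ln (\<tau> * \<beta>)))
            * (1 - \<beta> powr (1 / ln (\<tau> * \<beta>)))\<rfloor>)"

text \<open>The bound is read as \<open>\<infinity>\<close>, i.e. no restriction on the family, when \<open>\<tau> = \<infinity>\<close>.\<close>

definition within_bound :: "real \<Rightarrow> real \<Rightarrow> real \<Rightarrow> ereal \<Rightarrow> (real \<Rightarrow> real) set \<Rightarrow> bool" where
  "within_bound A D m \<tau> P \<longleftrightarrow>
     \<tau> = \<infinity> \<or> finite P \<and> int (card P) \<le> pattern_bound A D m (real_of_ereal \<tau>)"

end

theory Submission
  imports Defs "HOL-Real_Asymp.Real_Asymp"
begin

text \<open>Let \<open>\<tau>\<close> be the thickness of \<open>C\<close>.  Two gaps \<open>G\<close>, \<open>H\<close> of \<open>C\<close> are at distance at least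
  \<open>\<tau> min(|G|, |H|)\<close>, and every gap has length at most \<open>1 / \<tau>\<close>.  So for each \<open>f\<close> in the pattern the
  preimages of the gaps are obstacles of size \<open>|G| / c1 f\<close> which are \<open>\<tau> / A\<close>-separated in the same
  sense, and we look for points of \<open>I\<close> avoiding all of them.

  Let \<open>M = 2 ^ q\<close> be the largest power of two below \<open>\<tau> / A\<close> and split \<open>I\<close> into \<open>M\<close>-adic cells.  Call a
  cell of length \<open>r\<close> good if the obstacles of size at least \<open>r / M\<close> that meet it have total size at most
  \<open>r / 12\<close>.  By separation, the obstacles with sizes in one dyadic range below \<open>r / M\<close> contribute at most
  \<open>4 r / M\<close> per function, so those with sizes between \<open>r / M\<^sup>2\<close> and \<open>r / M\<close> contribute at most
  \<open>4 n q r / M\<close> for \<open>n\<close> functions.  The hypothesis on \<open>n\<close> makes \<open>n q\<close> small compared with \<open>M\<close>, whence at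
  least half of the \<open>M\<close> children of a good cell are good: at most a quarter of them meet an obstacle of
  size at least \<open>r / M\<close>, and by Markov's inequality at most a quarter are spoilt by the smaller ones.
  The good cells thus contain a binary tree, whose limit set has positive dimension.\<close>

section \<open>Hausdorff dimension of branching sets\<close>

text \<open>Covering the empty set by empty sets makes every measure of positive exponent vanish, so
  its dimension is at most every \<open>s > 0\<close>. Positive dimension therefore yields an actual
  point.\<close>

lemma hausdorff_dim_pos_nonempty:
  assumes "hausdorff_dim E > 0"
  shows "E \<noteq> {}"
proof
  assume "E = {}"
  have "hausdorff_premeasure s \<delta> E = 0" if "0 < \<delta>" for s \<delta>
  proof -
    have "hausdorff_premeasure s \<delta> E \<le> (\<Sum>i::nat. ennreal (diameter ({} :: 'a set) powr s))"
      unfolding hausdorff_premeasure_def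
      by (rule INF_lower2[of "\<lambda>_. {}"]) (use \<open>E = {}\<close> that in \<open>auto simp: diameter_def\<close>)
    then show ?thesis by (simp add: diameter_def)
  qed
  then have zero: "hausdorff_measure s E = 0" for s
    by (auto simp: hausdorff_measure_def intro!: antisym SUP_least)
  obtain s :: real where "0 < ereal s" "ereal s < hausdorff_dim E"
    using ereal_dense2[OF assms] by auto
  moreover have "hausdorff_dim E \<le> ereal s"
    unfolding hausdorff_dim_def using zero \<open>0 < ereal s\<close> by (intro Inf_lower) auto
  ultimately show False by simp
qed

text \<open>By \<open>sep\<close> the inverse of \<open>x\<close> is Hoelder with exponent
  \<open>ln 2 / ln M\<close>. A cover of \<open>E\<close> thus pulls back to a cover of
  \<open>[0,1)\<close> by intervals of length at most a constant times
  \<open>diameter (U i) powr s\<close>, and the length 1 of \<open>[0,1)\<close> bounds the sum from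
  below.\<close>

lemma hausdorff_dim_pos_of_separated:
  fixes x :: "real \<Rightarrow> 'a::metric_space" and M :: nat
  assumes M: "M \<ge> 2" and r: "r > 0"
    and E: "\<And>t. 0 \<le> t \<Longrightarrow> t < 1 \<Longrightarrow> x t \<in> E"
    and sep: "\<And>k t u. 0 \<le> t \<Longrightarrow> u < 1 \<Longrightarrow> 2 / 2 ^ k \<le> u - t \<Longrightarrow> r / real M ^ k \<le> dist (x t) (x u)"
  shows "hausdorff_dim E > 0"
proof -
  define s0 where "s0 = ln 2 / ln (real M)"
  have s0: "s0 > 0" using M by (simp add: s0_def)
  have "hausdorff_measure s E \<noteq> 0" if s: "0 < s" "s \<le> s0" for s
  proof -
    \<comment> \<open>The 8 is twice the Hoelder constant 4 below, since an interval of radius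
      \<open>w i\<close> has length \<open>2 * w i\<close>.\<close>
    define c where "c = 8 / r powr s"
    have c: "c > 0" using r by (simp add: c_def)
    have hoelder: "u - t \<le> 4 * (d / r) powr s"
      if tu: "0 \<le> t" "t < u" "u < 1" and d: "dist (x t) (x u) \<le> d" for t u d
    proof -
      \<comment> \<open>Minimality of \<open>k\<close> makes \<open>u - t\<close> comparable to
        \<open>1 / 2 ^ k\<close>; \<open>k\<close> is positive because
        \<open>u - t < 1\<close>.\<close>
      define k where "k = (LEAST k. 2 / 2 ^ k \<le> u - t)"
      have "(\<lambda>k. 2 / 2 ^ k :: real) \<longlonglongrightarrow> 0" by real_asymp
      then have "eventually (\<lambda>k. 2 / 2 ^ k < u - t) sequentially"
        using tu by (auto intro: order_tendstoD(2))
      then obtain N where "2 / 2 ^ N < u - t"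
        unfolding eventually_sequentially by blast
      then have "\<exists>k. 2 / 2 ^ k \<le> u - t" by (intro exI[of _ N]) simp
      then have k: "2 / 2 ^ k \<le> u - t" unfolding k_def by (rule LeastI_ex)
      then obtain j where j: "k = Suc j" using tu by (cases k) auto
      have "\<not> 2 / 2 ^ j \<le> u - t"
        using not_less_Least[of j "\<lambda>k. 2 / 2 ^ k \<le> u - t"] by (simp add: k_def[symmetric] j)
      then have "u - t \<le> 4 * (1 / 2 ^ k)" by (simp add: j)
      also have "1 / 2 ^ k = (1 / real M ^ k) powr s0"
      proof -
        have "real M powr s0 = 2" using M by (simp add: s0_def powr_def)
        then have "(real M ^ k) powr s0 = 2 ^ k"
          using powr_powr_swap[of "real M" "real k" s0] M
          by (simp add: powr_realpow)
        then show ?thesis using M by (simp add: powr_divide)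
      qed
      also have "\<dots> \<le> (1 / real M ^ k) powr s"
        using M s by (intro powr_mono') (auto simp: field_simps)
      also have "\<dots> \<le> (d / r) powr s"
      proof (rule powr_mono2)
        have "r / real M ^ k \<le> d" using sep[of t u k] tu k d by linarith
        then show "1 / real M ^ k \<le> d / r" using r by (simp add: field_simps)
      qed (use s in auto)
      finally show ?thesis by simp
    qed
    have "ennreal (1 / c) \<le> (\<Sum>i. ennreal (diameter (U i) powr s))"
      if U: "E \<subseteq> (\<Union>i. U i)" "\<And>i. bounded (U i)" for U :: "nat \<Rightarrow> 'a set"
    proof -
      define T where "T i = {t \<in> {0..<1}. x t \<in> U i}" for i
      \<comment> \<open>For empty \<open>T i\<close> the value is arbitrary, and the interval around
        it only has to contain the empty set. Enlarging \<open>T i\<close> to an interval also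
        settles measurability.\<close>
      define a where "a i = (SOME t. t \<in> T i)" for i
      define w where "w i = 4 * (diameter (U i) / r) powr s" for i
      have w0: "w i \<ge> 0" for i by (simp add: w_def)
      have T: "T i \<subseteq> {a i - w i..a i + w i}" for i
      proof
        fix t assume t: "t \<in> T i"
        then have a: "a i \<in> T i" unfolding a_def by (rule someI)
        have "\<bar>t - a i\<bar> \<le> w i"
        proof (cases t "a i" rule: linorder_cases)
          case less
          then show ?thesis using hoelder[of t "a i" "diameter (U i)"] t a U(2)
            by (auto simp: T_def w_def intro: diameter_bounded_bound)
        next
          case equal
          then show ?thesis using w0 by simp
        next
          case greater
          then show ?thesis using hoelder[of "a i" t "diameter (U i)"] t a U(2)
            by (auto simp: T_def w_def intro: diameter_bounded_bound)
        qed
        then show "t \<in> {a i - w i..a i + w i}" by auto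
      qed
      have "{0..<1} \<subseteq> (\<Union>i. T i)" using E U(1) by (force simp: T_def)
      also have "\<dots> \<subseteq> (\<Union>i. {a i - w i..a i + w i})" using T by blast
      finally have "emeasure lborel {0..<1::real} \<le> emeasure lborel (\<Union>i. {a i - w i..a i + w i})"
        by (rule emeasure_mono) auto
      also have "\<dots> \<le> (\<Sum>i. emeasure lborel {a i - w i..a i + w i})"
        by (rule emeasure_subadditive_countably) auto
      also have "\<dots> = (\<Sum>i. ennreal (c * diameter (U i) powr s))"
        using w0 r by (intro suminf_cong) (simp add: w_def c_def powr_divide diameter_ge_0 U(2))
      also have "\<dots> = ennreal c * (\<Sum>i. ennreal (diameter (U i) powr s))"
        using c by (simp add: ennreal_mult)
      finally have "ennreal (1 / c) * 1 \<le> ennreal (1 / c) * (ennreal c * (\<Sum>i. ennreal (diameter (U i) powr s)))"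
        by (intro mult_left_mono) auto
      then show ?thesis using c by (simp add: mult.assoc[symmetric] ennreal_mult[symmetric])
    qed
    then have "ennreal (1 / c) \<le> hausdorff_premeasure s 1 E"
      unfolding hausdorff_premeasure_def by (intro INF_greatest) auto
    also have "\<dots> \<le> hausdorff_measure s E"
      unfolding hausdorff_measure_def by (intro SUP_upper) auto
    finally show ?thesis using c by (auto simp: ennreal_eq_0_iff)
  qed
  then have "ereal s0 \<le> hausdorff_dim E"
    unfolding hausdorff_dim_def by (intro Inf_greatest) (auto, meson linear)
  then show ?thesis using s0 by (metis ereal_less(2) less_le_trans)
qed

section \<open>Binary trees of M-adic cells\<close>

definition cell :: "real \<Rightarrow> real \<Rightarrow> nat \<Rightarrow> nat \<Rightarrow> nat \<Rightarrow> real set" where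
  "cell a m M k p = {a + m * real p / real M ^ k..a + m * real (Suc p) / real M ^ k}"

lemma child_cell_subset:
  assumes "m > 0" "M > 0" "c < M"
  shows "cell a m M (Suc k) (M * p + c) \<subseteq> cell a m M k p"
proof -
  have "real (Suc (M * p + c)) \<le> real M * real (Suc p)"
    using assms by (metis Suc_leI mult_Suc_right add.commute nat_add_left_cancel_less add_Suc_right of_nat_le_iff of_nat_mult)
  moreover have "real M * real p \<le> real (M * p + c)" by simp
  ultimately have "m * (real M * real p) \<le> m * real (M * p + c)"
    "m * real (Suc (M * p + c)) \<le> m * (real M * real (Suc p))"
    using assms by (auto intro: mult_left_mono simp del: of_nat_Suc)
  moreover have "m * real q / real M ^ k = m * (real M * real q) / real M ^ Suc k" for q
    using assms by (simp add: field_simps)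
  ultimately show ?thesis
    using assms unfolding cell_def by (auto simp: divide_right_mono simp del: of_nat_Suc power_Suc)
qed

text \<open>Choosing two children of each admissible cell gives a binary tree, and the binary digits
  of \<open>t\<close> in \<open>[0,1)\<close> select a branch. Cells are closed, so each branch has
  a limit point; order is preserved, so \<open>hausdorff_dim_pos_of_separated\<close>
  applies.\<close>

lemma hausdorff_dim_pos_of_branching:
  assumes m: "m > 0" and M: "M \<ge> 2"
    and root: "Q 0 0"
    and split: "\<And>k p. Q k p \<Longrightarrow> \<exists>c d. c < d \<and> d < M \<and> Q (Suc k) (M * p + c) \<and> Q (Suc k) (M * p + d)"
    and E: "\<And>x. (\<And>k. \<exists>p. Q k p \<and> x \<in> cell a m M k p) \<Longrightarrow> x \<in> E"
  shows "hausdorff_dim E > 0"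
proof -
  obtain c d where cd: "\<And>k p. Q k p \<Longrightarrow> c k p < d k p \<and> d k p < M \<and>
      Q (Suc k) (M * p + c k p) \<and> Q (Suc k) (M * p + d k p)"
    using split by metis
  \<comment> \<open>For \<open>j < 2 ^ k\<close>, \<open>pos k j\<close> is the index of the
    level-\<open>k\<close> cell reached by following the \<open>k\<close> binary digits of
    \<open>j\<close>, the last digit choosing between the children \<open>c\<close> and
    \<open>d\<close>.\<close>
  define pos where "pos = rec_nat (\<lambda>j. 0)
    (\<lambda>k P j. M * P (j div 2) + (if even j then c k (P (j div 2)) else d k (P (j div (2::nat)))))"
  have pos0: "pos 0 j = 0" for j by (simp add: pos_def)
  have posS: "pos (Suc k) j = M * pos k (j div 2) +
      (if even j then c k (pos k (j div 2)) else d k (pos k (j div 2)))" for k j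
    by (simp add: pos_def)
  have Q: "Q k (pos k j)" for k j
    by (induction k arbitrary: j) (auto simp: pos0 posS root dest: cd)
  have posS_div: "\<exists>e<M. pos (Suc k) j = M * pos k (j div 2) + e" for k j
    using cd[OF Q[of k "j div 2"]] by (auto simp: posS)
  have pos_mono: "i < j \<Longrightarrow> j < 2 ^ k \<Longrightarrow> pos k i < pos k j" for k i j
  proof (induction k arbitrary: i j)
    case (Suc k)
    show ?case
    proof (cases "i div 2 = j div 2")
      case True
      then have "even i" "odd j" using Suc.prems(1) by presburger+
      then show ?thesis using True cd[OF Q[of k "j div 2"]] by (simp add: posS)
    next
      case False
      then have "i div 2 < j div 2" using Suc.prems(1) by linarith
      then have "pos k (i div 2) < pos k (j div 2)" using Suc by simp
      then have *: "M * Suc (pos k (i div 2)) \<le> M * pos k (j div 2)"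
        by (intro mult_le_mono2) simp
      obtain e e' where "e < M" "pos (Suc k) i = M * pos k (i div 2) + e"
        "pos (Suc k) j = M * pos k (j div 2) + e'"
        using posS_div by meson
      then show ?thesis using * by simp
    qed
  qed simp
  \<comment> \<open>\<open>idx k t\<close> reads the first \<open>k\<close> binary digits of
    \<open>t\<close> as a number.\<close>
  define idx where "idx k t = nat \<lfloor>2 ^ k * t\<rfloor>" for k and t :: real
  have idxS: "idx (Suc k) t div 2 = idx k t" if "0 \<le> t" for k t
  proof -
    have "\<lfloor>2 ^ k * t\<rfloor> = \<lfloor>(2 ^ Suc k * t) / real_of_int 2\<rfloor>" by simp
    also have "\<dots> = \<lfloor>2 ^ Suc k * t\<rfloor> div 2" by (rule floor_divide_real_eq_div) simp
    finally show ?thesis by (simp add: idx_def nat_div_distrib')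
  qed
  define lo where "lo k t = a + m * real (pos k (idx k t)) / real M ^ k" for k t
  \<comment> \<open>The cells \<open>J k t\<close> are nested, so the supremum of their left end
    points lies in all of them.\<close>
  define x where "x t = (SUP k. lo k t)" for t
  define J where "J k t = cell a m M k (pos k (idx k t))" for k t
  have J_eq: "J k t = {lo k t..lo k t + m / real M ^ k}" for k t
    by (simp add: J_def cell_def lo_def algebra_simps add_divide_distrib)
  have J_Suc: "J (Suc k) t \<subseteq> J k t" if t: "0 \<le> t" for k t
  proof -
    obtain e where "e < M" "pos (Suc k) (idx (Suc k) t) = M * pos k (idx k t) + e"
      using posS_div[of k "idx (Suc k) t"] by (auto simp: idxS[OF t])
    then show ?thesis using m M child_cell_subset[of m M e a k] by (simp add: J_def)
  qed
  have J_mono: "J l t \<subseteq> J k t" if "0 \<le> t" "k \<le> l" for k l t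
    using lift_Suc_antimono_le[of "\<lambda>k. J k t" k l] J_Suc that by blast
  have x_in: "x t \<in> J k t" if t: "0 \<le> t" for k t
  proof -
    have lo_in: "lo l t \<in> J l t" for l using m by (simp add: J_eq)
    have up: "lo l t \<le> lo k t + m / real M ^ k" for l k
    proof -
      have "lo (max k l) t \<le> lo k t + m / real M ^ k"
        using J_mono[OF t, of k "max k l"] lo_in[of "max k l"] by (auto simp: J_eq)
      moreover have "lo l t \<le> lo (max k l) t"
        using J_mono[OF t, of l "max k l"] lo_in[of "max k l"] by (auto simp: J_eq)
      ultimately show ?thesis by simp
    qed
    then have "bdd_above (range (\<lambda>l. lo l t))" by (meson bdd_above.I2)
    then have "lo k t \<le> x t" unfolding x_def by (rule cSUP_upper[rotated]) simp
    moreover have "x t \<le> lo k t + m / real M ^ k"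
      unfolding x_def using up by (intro cSUP_least) auto
    ultimately show ?thesis by (simp add: J_eq)
  qed
  show ?thesis
  proof (rule hausdorff_dim_pos_of_separated[OF M m])
    fix t :: real assume "0 \<le> t" "t < 1"
    then show "x t \<in> E" using x_in Q unfolding J_def by (blast intro: E)
  next
    fix k and t u :: real assume t: "0 \<le> t" and u: "u < 1" and tu: "2 / 2 ^ k \<le> u - t"
    have u0: "0 \<le> u" using t tu by (smt (verit) divide_nonneg_nonneg zero_le_power)
    \<comment> \<open>Adjacent cells share an end point. Two index steps put the left end points at
      least two cell lengths apart, and each limit point lies within one length of its left end
      point.\<close>
    have "2 ^ k * t + 2 \<le> 2 ^ k * u" using tu by (simp add: field_simps)
    then have "\<lfloor>2 ^ k * t\<rfloor> + 2 \<le> \<lfloor>2 ^ k * u\<rfloor>" by linarith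
    moreover have "0 \<le> \<lfloor>2 ^ k * t\<rfloor>" using t by simp
    ultimately have idx2: "Suc (Suc (idx k t)) \<le> idx k u" unfolding idx_def by linarith
    have "2 ^ k * u < 2 ^ k" using u by simp
    then have "\<lfloor>2 ^ k * u\<rfloor> < 2 ^ k" by (simp add: floor_less_iff)
    then have idx_lt: "idx k u < 2 ^ k"
      using u0 by (simp add: idx_def nat_less_iff)
    have "pos k (idx k t) < pos k (Suc (idx k t))" "pos k (Suc (idx k t)) < pos k (idx k u)"
      using idx2 idx_lt by (intro pos_mono; simp)+
    then have "real (pos k (idx k t)) + 2 \<le> real (pos k (idx k u))" by linarith
    then have "m * (real (pos k (idx k t)) + 2) / real M ^ k \<le> m * real (pos k (idx k u)) / real M ^ k"
      using m by (intro divide_right_mono mult_left_mono) auto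
    then have "lo k t + 2 * (m / real M ^ k) \<le> lo k u"
      by (simp add: lo_def algebra_simps add_divide_distrib)
    then have "m / real M ^ k \<le> x u - x t"
      using x_in[OF t, of k] x_in[OF u0, of k] by (auto simp: J_eq)
    then show "m / real M ^ k \<le> dist (x t) (x u)" by (simp add: dist_real_def)
  qed
qed

section \<open>Avoiding separated obstacles\<close>

text \<open>Rounding \<open>(x - u) / d\<close> down is injective on a \<open>d\<close>-separated
  set and takes at most \<open>floor (r / d) + 1\<close> values.\<close>

lemma card_separated_le:
  fixes S :: "real set"
  assumes S: "S \<subseteq> {u..u + r}" and d: "d > 0" and r: "r \<ge> 0"
    and sep: "\<And>x y. x \<in> S \<Longrightarrow> y \<in> S \<Longrightarrow> x \<noteq> y \<Longrightarrow> d \<le> \<bar>x - y\<bar>"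
  shows "finite S" "real (card S) \<le> 1 + r / d"
proof -
  define g where "g x = \<lfloor>(x - u) / d\<rfloor>" for x
  have inj: "inj_on g S"
  proof (rule inj_onI, rule ccontr)
    fix x y assume *: "x \<in> S" "y \<in> S" "g x = g y" "x \<noteq> y"
    have "\<bar>(x - u) / d - (y - u) / d\<bar> < 1" using *(3) unfolding g_def by linarith
    moreover have "\<bar>(x - u) / d - (y - u) / d\<bar> = \<bar>x - y\<bar> / d"
      using d by (simp add: diff_divide_distrib[symmetric] abs_divide)
    ultimately show False using sep[OF *(1,2,4)] d by (simp add: field_simps)
  qed
  have img: "g ` S \<subseteq> {0..\<lfloor>r / d\<rfloor>}"
  proof
    fix z assume "z \<in> g ` S"
    then obtain x where x: "x \<in> S" "z = g x" by blast
    have "0 \<le> x - u" "x - u \<le> r" using S x(1) by auto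
    then show "z \<in> {0..\<lfloor>r / d\<rfloor>}"
      using d unfolding x(2) g_def by (auto intro!: floor_mono divide_right_mono)
  qed
  show "finite S" using inj img finite_imageD finite_subset by blast
  have "card S \<le> card {0..\<lfloor>r / d\<rfloor>}"
    using inj img by (metis card_image card_mono finite_atLeastAtMost_int)
  moreover have "0 \<le> \<lfloor>r / d\<rfloor>" using d r by simp
  moreover have "card {0..\<lfloor>r / d\<rfloor>} = nat (\<lfloor>r / d\<rfloor> + 1)" by simp
  ultimately have "int (card S) \<le> \<lfloor>r / d\<rfloor> + 1" by linarith
  then show "real (card S) \<le> 1 + r / d" by linarith
qed

lemma card_nat_diff_le:
  fixes T :: "nat set"
  assumes "finite T" "D \<ge> 0" "\<And>c d. c \<in> T \<Longrightarrow> d \<in> T \<Longrightarrow> c < d \<Longrightarrow> real d - real c \<le> D"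
  shows "real (card T) \<le> D + 1"
proof (cases "T = {}")
  case False
  then have Min: "Min T \<in> T" and Max: "Max T \<in> T" using assms(1) by auto
  have "T \<subseteq> {Min T..Max T}" using assms(1) by auto
  then have "card T \<le> Suc (Max T) - Min T" by (metis card_atLeastAtMost card_mono finite_atLeastAtMost)
  moreover have "Min T \<le> Max T" using assms(1) Min by simp
  moreover have "real (Max T) - real (Min T) \<le> D"
    using assms(2,3) Min Max \<open>Min T \<le> Max T\<close> by (cases "Min T = Max T") auto
  ultimately show ?thesis by linarith
qed (use assms in simp)

text \<open>\<open>X i b\<close> is the obstacle that gap \<open>b\<close> causes for function
  \<open>i\<close>; \<open>\<delta> i b\<close> bounds its diameter and serves as its size. The
  separation factor \<open>M\<close> is also the branching number, and being \<open>2 ^ q\<close> it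
  spans \<open>q\<close> dyadic size ranges. In \<open>few\<close>, 576 is
  \<open>4 * 12 * 12\<close>: a quarter of the children, the threshold 1/12 of goodness, and three
  children per obstacle in a sum of \<open>4 * q * r\<close> per function.\<close>

locale obstacles =
  fixes \<Lambda> :: "'i set" and \<Gamma> :: "'b set" and X :: "'i \<Rightarrow> 'b \<Rightarrow> real set" and \<delta> :: "'i \<Rightarrow> 'b \<Rightarrow> real"
    and M q :: nat
  assumes finite_index: "finite \<Lambda>"
    and size_pos: "i \<in> \<Lambda> \<Longrightarrow> b \<in> \<Gamma> \<Longrightarrow> 0 < \<delta> i b"
    and diam: "i \<in> \<Lambda> \<Longrightarrow> b \<in> \<Gamma> \<Longrightarrow> x \<in> X i b \<Longrightarrow> y \<in> X i b \<Longrightarrow> \<bar>x - y\<bar> \<le> \<delta> i b"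
    and separated: "i \<in> \<Lambda> \<Longrightarrow> b \<in> \<Gamma> \<Longrightarrow> b' \<in> \<Gamma> \<Longrightarrow> b \<noteq> b' \<Longrightarrow> x \<in> X i b \<Longrightarrow> y \<in> X i b' \<Longrightarrow>
      real M * min (\<delta> i b) (\<delta> i b') \<le> \<bar>x - y\<bar>"
    and M_eq: "M = 2 ^ q" and q: "q \<ge> 2"
    and few: "576 * card \<Lambda> * q \<le> M"
begin

lemma M_ge: "M \<ge> 4"
  using power_increasing[OF q, of "2::nat"] by (simp add: M_eq)

definition hits :: "'i \<Rightarrow> real set \<Rightarrow> real \<Rightarrow> 'b set" where
  "hits i J L = {b \<in> \<Gamma>. X i b \<inter> J \<noteq> {} \<and> L \<le> \<delta> i b}"

text \<open>One point chosen from each counted obstacle gives an \<open>M * L\<close>-separated set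
  in the interval.\<close>

lemma hits_card:
  fixes L r u :: real
  assumes i: "i \<in> \<Lambda>" and L: "L > 0" and r: "r \<ge> 0"
  shows "finite (hits i {u..u + r} L)" "real (card (hits i {u..u + r} L)) \<le> 1 + r / (M * L)"
proof -
  let ?H = "hits i {u..u + r} L"
  define g where "g b = (SOME x. x \<in> X i b \<inter> {u..u + r})" for b
  have g: "g b \<in> X i b \<inter> {u..u + r}" if "b \<in> ?H" for b
    using that unfolding g_def hits_def by (auto intro!: someI_ex[of "\<lambda>x. x \<in> X i b \<and> u \<le> x \<and> x \<le> u + r"])
  have step_pos: "real M * L > 0" using M_ge L by simp
  have sep: "real M * L \<le> \<bar>g b - g b'\<bar>" if "b \<in> ?H" "b' \<in> ?H" "b \<noteq> b'" for b b'
  proof -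
    have "real M * L \<le> real M * min (\<delta> i b) (\<delta> i b')" using that by (intro mult_left_mono) (auto simp: hits_def)
    also have "\<dots> \<le> \<bar>g b - g b'\<bar>"
      using that g[of b] g[of b'] i by (intro separated) (auto simp: hits_def)
    finally show ?thesis .
  qed
  have inj: "inj_on g ?H" using sep step_pos by (force intro!: inj_onI)
  have "g ` ?H \<subseteq> {u..u + r}" using g by auto
  note * = card_separated_le[OF this step_pos r]
  have sep': "real M * L \<le> \<bar>x - y\<bar>" if "x \<in> g ` ?H" "y \<in> g ` ?H" "x \<noteq> y" for x y
    using that sep by blast
  show "finite ?H" using *(1)[OF sep'] inj finite_imageD by blast
  show "real (card ?H) \<le> 1 + r / (M * L)" using *(2)[OF sep'] inj by (simp add: card_image)
qed

text \<open>Sizes in \<open>[L', 2 * L')\<close> occur at most \<open>1 + r / (M * L')\<close>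
  times, and the 1 is absorbed because \<open>M * L' \<le> r\<close>. So each dyadic range
  contributes at most \<open>4 * r / M\<close>, whatever \<open>L'\<close> is, and the induction on
  \<open>j\<close> adds the ranges.\<close>

lemma dyadic_sum_le:
  fixes L r u :: real
  assumes i: "i \<in> \<Lambda>" and L: "L > 0" and "real M * (2 ^ j * L) \<le> r"
  shows "(\<Sum>b \<in> {b \<in> hits i {u..u + r} L. \<delta> i b < 2 ^ j * L}. \<delta> i b) \<le> 4 * j * r / M"
  using assms(3)
proof (induction j)
  case 0
  have "{b \<in> hits i {u..u + r} L. \<delta> i b < 2 ^ 0 * L} = {}" by (auto simp: hits_def)
  then show ?case by (simp only: sum.empty)
next
  case (Suc j)
  let ?H = "hits i {u..u + r}"
  define L' where "L' = 2 ^ j * L"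
  have L': "L' > 0" "L \<le> L'" using L by (auto simp: L'_def mult_le_cancel_right1)
  have Mpos: "real M > 0" using M_ge by simp
  have L_le: "real M * (2 * L') \<le> r" using Suc.prems by (simp add: L'_def mult.assoc)
  then have le: "real M * L' \<le> r" using Mpos L' by (smt (verit) mult_pos_pos mult_left_mono)
  then have r: "r \<ge> 0" using Mpos L' by (smt (verit) mult_pos_pos)
  have fin: "finite (?H L)" "finite (?H L')" using hits_card(1)[OF i _ r] L L' by auto
  have eq: "{b \<in> ?H L. \<delta> i b < 2 ^ Suc j * L} =
      {b \<in> ?H L. \<delta> i b < 2 ^ j * L} \<union> {b \<in> ?H L'. \<delta> i b < 2 * L'}"
    using L' by (auto simp: hits_def L'_def)
  have "(\<Sum>b \<in> {b \<in> ?H L'. \<delta> i b < 2 * L'}. \<delta> i b) \<le> (\<Sum>b \<in> {b \<in> ?H L'. \<delta> i b < 2 * L'}. 2 * L')"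
    by (intro sum_mono) auto
  also have "\<dots> \<le> real (card (?H L')) * (2 * L')"
    using fin L' by (simp add: card_mono)
  also have "\<dots> \<le> (1 + r / (M * L')) * (2 * L')"
    using hits_card(2)[OF i L'(1) r] L' by (intro mult_right_mono) auto
  also have "\<dots> \<le> 4 * r / M"
    using le L' Mpos by (simp add: field_simps)
  finally have top: "(\<Sum>b \<in> {b \<in> ?H L'. \<delta> i b < 2 * L'}. \<delta> i b) \<le> 4 * r / M" .
  have "(\<Sum>b \<in> {b \<in> ?H L. \<delta> i b < 2 ^ Suc j * L}. \<delta> i b) =
      (\<Sum>b \<in> {b \<in> ?H L. \<delta> i b < 2 ^ j * L}. \<delta> i b) + (\<Sum>b \<in> {b \<in> ?H L'. \<delta> i b < 2 * L'}. \<delta> i b)"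
    unfolding eq
  proof (rule sum.union_disjoint)
    show "finite {b \<in> ?H L. \<delta> i b < 2 ^ j * L}" "finite {b \<in> ?H L'. \<delta> i b < 2 * L'}"
      using fin by simp_all
    show "{b \<in> ?H L. \<delta> i b < 2 ^ j * L} \<inter> {b \<in> ?H L'. \<delta> i b < 2 * L'} = {}"
      by (auto simp: hits_def L'_def)
  qed
  also have "\<dots> \<le> 4 * j * r / M + 4 * r / M"
    using Suc.IH le top by (simp add: L'_def)
  also have "\<dots> = 4 * real (Suc j) * r / M" by (simp add: add_divide_distrib algebra_simps)
  finally show ?case .
qed

text \<open>Two cells of length \<open>r\<close> met by one obstacle have indices at most
  \<open>\<delta> i b / r + 1\<close> apart; closed cells sharing an end point both count.\<close>

lemma hit_children_card:
  assumes i: "i \<in> \<Lambda>" and b: "b \<in> \<Gamma>" and m: "m > 0"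
  shows "real (card {c. c < M \<and> X i b \<inter> cell a m M k (s + c) \<noteq> {}}) \<le> \<delta> i b / (m / real M ^ k) + 2"
proof -
  define r where "r = m / real M ^ k"
  have r: "r > 0" using m M_ge by (simp add: r_def)
  have cell: "cell a m M k p = {a + r * real p..a + r * real p + r}" for p
    by (simp add: cell_def r_def algebra_simps add_divide_distrib)
  have "real (card {c. c < M \<and> X i b \<inter> cell a m M k (s + c) \<noteq> {}}) \<le> (\<delta> i b / r + 1) + 1"
  proof (rule card_nat_diff_le)
    show "0 \<le> \<delta> i b / r + 1" using size_pos[OF i b] r by simp
    fix c d assume *: "c \<in> {c. c < M \<and> X i b \<inter> cell a m M k (s + c) \<noteq> {}}"
      "d \<in> {c. c < M \<and> X i b \<inter> cell a m M k (s + c) \<noteq> {}}"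
    then obtain x y where xy: "x \<in> X i b" "y \<in> X i b" and x: "x \<le> a + r * real (s + c) + r"
      and y: "a + r * real (s + d) \<le> y"
      by (auto simp: cell)
    have "r * (real d - real c - 1) \<le> y - x" using x y by (simp add: algebra_simps)
    also have "\<dots> \<le> \<delta> i b" using diam[OF i b xy] by simp
    finally show "real d - real c \<le> \<delta> i b / r + 1" using r by (simp add: field_simps)
  qed simp
  then show ?thesis by (simp add: r_def)
qed

section \<open>Good cells and their children\<close>

definition large_hits :: "real \<Rightarrow> real \<Rightarrow> nat \<Rightarrow> nat \<Rightarrow> ('i \<times> 'b) set" where
  "large_hits a m k p = (SIGMA i:\<Lambda>. hits i (cell a m M k p) (m / real M ^ Suc k))"

text \<open>Sizes are summed separately for each function, so overlaps count repeatedly. The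
  threshold 1/12 is chosen because an obstacle at least as long as a child meets at most
  \<open>3 * \<delta> i b / r\<close> children of length \<open>r\<close>, altogether at most a
  quarter of them.\<close>

definition good :: "real \<Rightarrow> real \<Rightarrow> nat \<Rightarrow> nat \<Rightarrow> bool" where
  "good a m k p \<longleftrightarrow> (\<Sum>(i, b) \<in> large_hits a m k p. \<delta> i b) \<le> m / real M ^ k / 12"

lemma cell_eq: "cell a m M k p =
    {a + m * real p / real M ^ k..a + m * real p / real M ^ k + m / real M ^ k}"
  by (simp add: cell_def algebra_simps add_divide_distrib)

lemma finite_large_hits:
  assumes "m > 0"
  shows "finite (large_hits a m k p)"
  using assms finite_index M_ge hits_card(1) unfolding large_hits_def cell_eq by auto

lemma good_splits:
  assumes m: "m > 0" and good: "good a m k p"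
  shows "\<exists>c d. c < d \<and> d < M \<and> good a m (Suc k) (M * p + c) \<and> good a m (Suc k) (M * p + d)"
proof -
  define r where "r = m / real M ^ Suc k"
  have Mpos: "real M > 0" using M_ge by simp
  have r: "r > 0" using m Mpos by (simp add: r_def)
  have r_up: "m / real M ^ k = M * r" and r_down: "m / real M ^ Suc (Suc k) = r / M"
    using Mpos by (simp_all add: r_def)
  \<comment> \<open>\<open>T1\<close> holds the obstacles of size at least the child length
    \<open>r\<close>, \<open>T2\<close> those between \<open>r / M\<close> and \<open>r\<close>.
    \<open>B1\<close> will collect the children met by the former, \<open>B2\<close> those
    overloaded by the latter.\<close>
  define T1 where "T1 = large_hits a m k p"
  define T2 where "T2 = (SIGMA i:\<Lambda>. {b \<in> hits i (cell a m M k p) (r / M). \<delta> i b < r})"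
  define hit where "hit = (\<lambda>(i, b). {c. c < M \<and> X i b \<inter> cell a m M (Suc k) (M * p + c) \<noteq> {}})"
  define sz where "sz = (\<lambda>(i, b). \<delta> i b)"
  have finhit: "finite (hit w)" for w by (cases w) (simp add: hit_def)
  have fin1: "finite T1" using m unfolding T1_def by (rule finite_large_hits)
  have fin_hits: "finite (hits i (cell a m M k p) (r / M))" if "i \<in> \<Lambda>" for i
    using hits_card(1)[OF that] r m Mpos unfolding cell_eq by simp
  then have fin2: "finite T2" using finite_index unfolding T2_def by auto
  have card_hit: "real (card (hit w)) \<le> sz w / r + 2" "sz w > 0" if "w \<in> \<Lambda> \<times> \<Gamma>" for w
    using that hit_children_card[of "fst w" "snd w" m a "Suc k" "M * p"] m size_pos
    by (auto simp: hit_def sz_def r_def)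
  have sub: "T1 \<subseteq> \<Lambda> \<times> \<Gamma>" "T2 \<subseteq> \<Lambda> \<times> \<Gamma>"
    by (auto simp: T1_def T2_def large_hits_def hits_def)
  have ge1: "r \<le> sz w" if "w \<in> T1" for w
    using that by (auto simp: T1_def large_hits_def hits_def r_def sz_def)
  have lt2: "sz w < r" if "w \<in> T2" for w
    using that by (auto simp: T2_def sz_def)
  define B1 where "B1 = (\<Union>w\<in>T1. hit w)"
  define B2 where "B2 = {c. c < M \<and> r / 12 < (\<Sum>w \<in> {w \<in> T2. c \<in> hit w}. sz w)}"
  have B1: "real (card B1) \<le> M / 4"
  proof -
    have "card B1 \<le> (\<Sum>w\<in>T1. card (hit w))"
      unfolding B1_def by (rule card_UN_le[OF fin1])
    then have "real (card B1) \<le> (\<Sum>w\<in>T1. real (card (hit w)))"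
      by (metis of_nat_le_iff of_nat_sum)
    also have "\<dots> \<le> (\<Sum>w\<in>T1. 3 / r * sz w)"
    proof (rule sum_mono)
      fix w assume w: "w \<in> T1"
      have "1 \<le> sz w / r" using ge1[OF w] r by simp
      then show "real (card (hit w)) \<le> 3 / r * sz w" using card_hit(1)[of w] w sub by auto
    qed
    also have "\<dots> = 3 / r * (\<Sum>w\<in>T1. sz w)" by (simp add: sum_distrib_left)
    also have "\<dots> \<le> 3 / r * (M * r / 12)"
      using good r unfolding good_def T1_def sz_def r_up by (intro mult_left_mono) auto
    finally show ?thesis using r by simp
  qed
  have fin_B2: "finite B2" by (simp add: B2_def)
  have B2: "real (card B2) \<le> M / 4"
  proof -
    \<comment> \<open>Markov's inequality, followed by an exchange of summation; an obstacle shorter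
      than a child meets fewer than three children.\<close>
    have "real (card B2) * (r / 12) \<le> (\<Sum>c\<in>B2. \<Sum>w \<in> {w \<in> T2. c \<in> hit w}. sz w)"
      by (rule sum_bounded_below) (auto simp: B2_def)
    also have "\<dots> = (\<Sum>w\<in>T2. \<Sum>c \<in> {c \<in> B2. c \<in> hit w}. sz w)"
      using fin2 fin_B2 by (rule sum.swap_restrict[symmetric, OF _ _])
    also have "\<dots> \<le> (\<Sum>w\<in>T2. 3 * sz w)"
    proof (rule sum_mono)
      fix w assume w: "w \<in> T2"
      have "sz w / r < 1" using lt2[OF w] r by simp
      then have "card (hit w) < 3" using card_hit(1)[of w] w sub by auto
      then have "card (hit w) \<le> 3" by simp
      moreover have "card {c \<in> B2. c \<in> hit w} \<le> card (hit w)" by (intro card_mono finhit) auto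
      ultimately have "real (card {c \<in> B2. c \<in> hit w}) \<le> 3" by simp
      then show "(\<Sum>c \<in> {c \<in> B2. c \<in> hit w}. sz w) \<le> 3 * sz w"
        using card_hit(2)[of w] w sub by (auto intro: mult_right_mono)
    qed
    also have "\<dots> = 3 * (\<Sum>i\<in>\<Lambda>. \<Sum>b\<in>{b \<in> hits i (cell a m M k p) (r / M). \<delta> i b < r}. \<delta> i b)"
      unfolding T2_def sz_def using finite_index fin_hits
      by (subst sum.Sigma) (auto simp: sum_distrib_left)
    also have "\<dots> \<le> 3 * (\<Sum>i\<in>\<Lambda>. 4 * q * r)"
    proof (intro mult_left_mono sum_mono)
      fix i assume i: "i \<in> \<Lambda>"
      \<comment> \<open>Between \<open>r / M\<close> and \<open>r\<close> there are \<open>q\<close>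
        dyadic ranges, counted in the parent, whose length is \<open>M * r\<close>.\<close>
      have "r = 2 ^ q * (r / M)" using Mpos by (simp add: M_eq)
      then show "(\<Sum>b\<in>{b \<in> hits i (cell a m M k p) (r / M). \<delta> i b < r}. \<delta> i b) \<le> 4 * q * r"
        using dyadic_sum_le[OF i, of "r / M" q "M * r" "a + m * real p / real M ^ k"] r Mpos
        unfolding cell_eq r_up by simp
    qed simp
    also have "\<dots> = r / 48 * (576 * card \<Lambda> * q)" by simp
    also have "\<dots> \<le> r / 48 * M" using few r by (intro mult_left_mono) (simp_all flip: of_nat_mult)
    finally show ?thesis using r by (simp add: field_simps)
  qed
  have good': "good a m (Suc k) (M * p + c)" if c: "c < M" "c \<notin> B1" "c \<notin> B2" for c
  proof -
    have small: "large_hits a m (Suc k) (M * p + c) \<subseteq> {w \<in> T2. c \<in> hit w}"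
    proof
      fix w assume w: "w \<in> large_hits a m (Suc k) (M * p + c)"
      obtain i b where wib: "w = (i, b)" by (cases w)
      have ib: "i \<in> \<Lambda>" "b \<in> \<Gamma>" "X i b \<inter> cell a m M (Suc k) (M * p + c) \<noteq> {}" "r / M \<le> \<delta> i b"
        using w unfolding wib large_hits_def r_down by (auto simp: hits_def)
      have "cell a m M (Suc k) (M * p + c) \<subseteq> cell a m M k p"
        using m M_ge c by (intro child_cell_subset) auto
      then have par: "X i b \<inter> cell a m M k p \<noteq> {}" using ib(3) by blast
      have hit: "c \<in> hit w" using c ib by (simp add: wib hit_def)
      \<comment> \<open>An obstacle of size at least \<open>r\<close> that meets the child also
        meets its parent, hence lies in \<open>T1\<close> and puts \<open>c\<close> into
        \<open>B1\<close>.\<close>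
      have "\<delta> i b < r"
      proof (rule ccontr)
        assume "\<not> \<delta> i b < r"
        then have "w \<in> T1" using ib par by (simp add: wib T1_def large_hits_def hits_def r_def)
        then show False using c hit by (auto simp: B1_def)
      qed
      then show "w \<in> {w \<in> T2. c \<in> hit w}" using ib par hit by (simp add: wib T2_def hits_def)
    qed
    have "(\<Sum>w\<in>large_hits a m (Suc k) (M * p + c). sz w) \<le> (\<Sum>w \<in> {w \<in> T2. c \<in> hit w}. sz w)"
    proof (rule sum_mono2)
      fix w assume "w \<in> {w \<in> T2. c \<in> hit w} - large_hits a m (Suc k) (M * p + c)"
      then show "0 \<le> sz w" using card_hit(2)[of w] sub by auto
    qed (use fin2 small in auto)
    also have "\<dots> \<le> r / 12" using c by (simp add: B2_def)
    finally show ?thesis unfolding good_def sz_def r_def .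
  qed
  define A where "A = {..<M} - (B1 \<union> B2)"
  have "M \<le> card A + (card B1 + card B2)"
    using diff_card_le_card_Diff[of "B1 \<union> B2" "{..<M}"] card_Un_le[of B1 B2] fin1 finhit fin_B2
    by (auto simp: A_def B1_def)
  then have "real M \<le> card A + M / 4 + M / 4" using B1 B2 by linarith
  \<comment> \<open>At least half of the \<open>M \<ge> 4\<close> children remain.\<close>
  then have "card A \<ge> 2" using M_ge by linarith
  then obtain c d where "c \<in> A" "d \<in> A" "c \<noteq> d"
    by (metis card_le_Suc0_iff_eq card.infinite not_less_eq_eq numeral_2_eq_2 le0)
  then have "\<exists>c d. c \<in> A \<and> d \<in> A \<and> c < d" by (metis linorder_neqE_nat)
  then show ?thesis using good' unfolding A_def by blast
qed

text \<open>The root is good since each function has at most two obstacles of size at least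
  \<open>m / M\<close> there, of total size at most \<open>2 * s\<close>. A point lying in good
  cells of all levels avoids every obstacle, since a cell shorter than an obstacle it meets cannot
  be good.\<close>

lemma hausdorff_dim_pos:
  fixes a m s :: real
  assumes m: "m > 0"
    and size_le: "\<And>i b. i \<in> \<Lambda> \<Longrightarrow> b \<in> \<Gamma> \<Longrightarrow> \<delta> i b \<le> s" and s0: "s \<ge> 0" and s: "24 * card \<Lambda> * s \<le> m"
    and E: "{a..a + m} - (\<Union>i\<in>\<Lambda>. \<Union>b\<in>\<Gamma>. X i b) \<subseteq> E"
  shows "hausdorff_dim E > 0"
\<comment> \<open>The clause \<open>p < M ^ k\<close> keeps the cells inside the root; at level 0 it
  leaves only \<open>p = 0\<close>.\<close>
proof (rule hausdorff_dim_pos_of_branching[OF m, of M "\<lambda>k p. good a m k p \<and> p < M ^ k"])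
  show "2 \<le> M" using M_ge by simp
  have Mpos: "real M > 0" using M_ge by simp
  show "good a m 0 0 \<and> 0 < M ^ 0"
  proof -
    let ?H = "\<lambda>i. hits i {a..a + m} (m / M)"
    have fin: "finite (?H i)" and card2: "real (card (?H i)) \<le> 2" if "i \<in> \<Lambda>" for i
      using hits_card[OF that, of "m / M" m a] m Mpos by auto
    have "(\<Sum>(i, b) \<in> large_hits a m 0 0. \<delta> i b) = (\<Sum>i\<in>\<Lambda>. \<Sum>b\<in>?H i. \<delta> i b)"
      using fin finite_index by (simp add: large_hits_def sum.Sigma cell_def)
    also have "\<dots> \<le> (\<Sum>i\<in>\<Lambda>. 2 * s)"
    proof (rule sum_mono)
      fix i assume i: "i \<in> \<Lambda>"
      show "(\<Sum>b\<in>?H i. \<delta> i b) \<le> 2 * s"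
      proof -
        have "(\<Sum>b\<in>?H i. \<delta> i b) \<le> real (card (?H i)) * s"
          using size_le[OF i] by (intro sum_bounded_above) (auto simp: hits_def)
        also have "\<dots> \<le> 2 * s" using card2[OF i] s0 by (intro mult_right_mono) auto
        finally show ?thesis .
      qed
    qed
    also have "\<dots> \<le> m / 12" using s by simp
    finally show ?thesis by (simp add: good_def)
  qed
  show "\<exists>c d. c < d \<and> d < M \<and>
      (good a m (Suc k) (M * p + c) \<and> M * p + c < M ^ Suc k) \<and>
      (good a m (Suc k) (M * p + d) \<and> M * p + d < M ^ Suc k)"
    if Q: "good a m k p \<and> p < M ^ k" for k p
  proof -
    obtain c d where cd: "c < d" "d < M" "good a m (Suc k) (M * p + c)" "good a m (Suc k) (M * p + d)"
      using good_splits[OF m] Q by blast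
    have "M * Suc p \<le> M * M ^ k" using Q by (intro mult_le_mono2) simp
    then have "M * p + d < M ^ Suc k" using cd(2) by simp
    then show ?thesis using cd by (intro exI[of _ c] exI[of _ d]) simp
  qed
  show "x \<in> E" if x: "\<And>k. \<exists>p. (good a m k p \<and> p < M ^ k) \<and> x \<in> cell a m M k p" for x
  proof -
    have "x \<in> {a..a + m}" using x[of 0] by (auto simp: cell_def)
    moreover have "x \<notin> X i b" if ib: "i \<in> \<Lambda>" "b \<in> \<Gamma>" for i b
    proof
      assume xX: "x \<in> X i b"
      have "(\<lambda>k. m / real M ^ k) \<longlonglongrightarrow> 0"
        using M_ge by real_asymp
      then have "eventually (\<lambda>k. m / real M ^ k < \<delta> i b) sequentially"
        using size_pos[OF ib] by (rule order_tendstoD(2))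
      then obtain k where k: "m / real M ^ k < \<delta> i b"
        unfolding eventually_sequentially by blast
      obtain p where p: "good a m k p" "x \<in> cell a m M k p" using x by blast
      have "m / real M ^ Suc k \<le> m / real M ^ k"
        using m M_ge by (intro divide_left_mono power_increasing) auto
      then have mem: "(i, b) \<in> large_hits a m k p"
        using ib p(2) xX k by (auto simp: large_hits_def hits_def)
      have "(case (i, b) of (i, b) \<Rightarrow> \<delta> i b) \<le> (\<Sum>(i, b) \<in> large_hits a m k p. \<delta> i b)"
      proof (rule member_le_sum[OF mem _ finite_large_hits[OF m]])
        fix w assume "w \<in> large_hits a m k p - {(i, b)}"
        then show "0 \<le> (case w of (i, b) \<Rightarrow> \<delta> i b)"
          using size_pos by (auto simp: large_hits_def hits_def intro: less_imp_le)
      qed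
      then have "\<delta> i b \<le> (\<Sum>(i, b) \<in> large_hits a m k p. \<delta> i b)" by simp
      also have "\<dots> \<le> m / real M ^ k / 12" using p(1) by (simp add: good_def)
      also have "\<dots> \<le> m / real M ^ k / 1" using m by (intro divide_left_mono) auto
      finally show False using k by simp
    qed
    ultimately show ?thesis using E by blast
  qed
qed

end

section \<open>The cardinality bound\<close>

lemma pattern_beta_bounds:
  assumes "A \<ge> 1" "D > 0" "m > 0"
  shows "0 < pattern_beta A D m" "pattern_beta A D m \<le> 1 / 4"
    "pattern_beta A D m \<le> m / D"
proof -
  show "0 < pattern_beta A D m" using assms by (simp add: pattern_beta_def)
  have "pattern_beta A D m \<le> 1 / (4 * A)" unfolding pattern_beta_def by (rule min.cobounded2)
  also have "\<dots> \<le> 1 / (4 * 1)" using assms by (intro divide_left_mono) auto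
  finally show "pattern_beta A D m \<le> 1 / 4" by simp
  show "pattern_beta A D m \<le> m / D" by (simp add: pattern_beta_def)
qed

text \<open>For \<open>0 < x \<le> 1\<close> the exponent \<open>1 / ln x\<close> is at most 0 (at
  \<open>x = 1\<close> by the convention \<open>1 / 0 = 0\<close>), so the last factor is
  nonpositive as \<open>\<beta> < 1\<close>. This range thus admits only the empty pattern.\<close>

lemma pattern_bound_nonpos:
  assumes "A \<ge> 1" "D > 0" "m > 0" "\<tau> \<ge> 0" "\<tau> * pattern_beta A D m \<le> 1"
  shows "pattern_bound A D m \<tau> \<le> 0"
proof -
  define \<beta> where "\<beta> = pattern_beta A D m"
  note \<beta> = pattern_beta_bounds[OF assms(1-3), folded \<beta>_def]
  define x where "x = \<tau> * \<beta>"
  have x: "0 \<le> x" "x \<le> 1" using assms \<beta> by (auto simp: x_def \<beta>_def)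
  have "x / (720\<^sup>2 * exp 1 * A powr (1 - 1 / ln x)) * (1 - \<beta> powr (1 / ln x)) \<le> 0"
  proof (cases "x = 0")
    case False
    then have "ln x \<le> 0" using x by simp
    then have "\<beta> powr 0 \<le> \<beta> powr (1 / ln x)" using \<beta> by (intro powr_mono') auto
    then show ?thesis using x \<beta> by (intro mult_nonneg_nonpos divide_nonneg_nonneg) auto
  qed simp
  then show ?thesis
    unfolding pattern_bound_def Let_def \<beta>_def[symmetric] x_def[symmetric]
    by (simp add: floor_le_iff)
qed

lemma exists_power_two_ivl:
  fixes x :: real
  assumes "1 \<le> x"
  shows "\<exists>q. 2 ^ q \<le> x \<and> x < 2 * 2 ^ q"
proof -
  have "1 \<le> nat \<lfloor>x\<rfloor>" using assms by (simp add: le_nat_iff le_floor_iff)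
  then obtain q where "2 ^ q \<le> nat \<lfloor>x\<rfloor>" "nat \<lfloor>x\<rfloor> < 2 ^ (q + 1)"
    using ex_power_ivl1[of 2] by force
  then have "real (2 ^ q) \<le> real (nat \<lfloor>x\<rfloor>)" "real (Suc (nat \<lfloor>x\<rfloor>)) \<le> real (2 ^ (q + 1))"
    by (simp_all only: of_nat_le_iff Suc_le_eq)
  then have "(2::real) ^ q \<le> of_int \<lfloor>x\<rfloor>" "of_int \<lfloor>x\<rfloor> + 1 \<le> 2 * (2 ^ q :: real)"
    using assms by simp_all
  then have "2 ^ q \<le> x" "x < 2 * 2 ^ q" by linarith+
  then show ?thesis by blast
qed

text \<open>With \<open>L = ln (\<tau>\<beta>) \<ge> 1\<close>, the bound being at least \<open>1\<close> forces \<open>ln A \<le> L\<close>, so the factor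
  \<open>A powr (1 / L)\<close> is at most \<open>e\<close>; then \<open>\<beta> (1 - \<beta> powr (1 / L)) ln (\<tau> / A)\<close> is at most \<open>2 b exp (- b)\<close>
  for \<open>b = - ln \<beta>\<close>, because \<open>ln \<tau> = L + b\<close> and \<open>1 - exp (- b / L) \<le> min 1 (b / L)\<close>.\<close>

lemma pattern_bound_scale:
  fixes n :: nat
  assumes A: "A \<ge> 1" and "D > 0" "m > 0" and big: "exp 1 \<le> \<tau> * pattern_beta A D m"
    and n: "n \<ge> 1" "int n \<le> pattern_bound A D m \<tau>"
  shows "24 * real n \<le> \<tau> * pattern_beta A D m"
    and "\<exists>q. q \<ge> 2 \<and> 576 * n * q \<le> 2 ^ q \<and> 2 ^ q \<le> \<tau> / A"
proof -
  define \<beta> where "\<beta> = pattern_beta A D m"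
  note \<beta> = pattern_beta_bounds[OF assms(1-3), folded \<beta>_def]
  define L where "L = ln (\<tau> * \<beta>)"
  define b where "b = - ln \<beta>"
  have x0: "\<tau> * \<beta> > 0" using big by (smt (verit) exp_gt_zero \<beta>_def)
  then have \<tau>: "\<tau> > 0" using \<beta>(1) by (simp add: zero_less_mult_iff)
  have L: "L \<ge> 1" using big x0 unfolding L_def \<beta>_def[symmetric] by (subst ln_ge_iff) auto
  have b: "b > 0" using \<beta> by (simp add: b_def)
  have expb: "\<beta> = exp (- b)" and expL: "\<tau> * \<beta> = exp L" using \<beta> x0 by (simp_all add: b_def L_def)
  define h where "h = 1 - \<beta> powr (1 / L)"
  have h: "h = 1 - exp (- (b / L))" using \<beta> by (simp add: h_def powr_def b_def)
  have h1: "h \<le> 1" and hb: "h \<le> b / L" and h0: "0 \<le> h"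
    using exp_ge_add_one_self[of "- (b / L)"] b L by (simp_all add: h)
  have "real n \<le> \<tau> * \<beta> / (720\<^sup>2 * exp 1 * A powr (1 - 1 / L)) * h"
    using n(2) unfolding pattern_bound_def Let_def \<beta>_def[symmetric] L_def[symmetric] h_def
    by (simp add: le_floor_iff)
  moreover have Apow: "1 \<le> A powr (1 - 1 / L)" using A L by (intro ge_one_powr_ge_zero) auto
  ultimately have n_le: "real n * (720\<^sup>2 * exp 1 * A powr (1 - 1 / L)) \<le> \<tau> * \<beta> * h"
    using A by (simp add: pos_le_divide_eq)
  have xh: "\<tau> * \<beta> * h \<le> \<tau> * \<beta>"
    using mult_left_mono[OF h1, of "\<tau> * \<beta>"] x0 by simp
  have e1: "(1::real) \<le> exp 1" by simp
  have "real n * (720\<^sup>2 * 1 * 1) \<le> real n * (720\<^sup>2 * exp 1 * A powr (1 - 1 / L))"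
    using Apow e1 by (intro mult_left_mono mult_mono) auto
  also have "\<dots> \<le> \<tau> * \<beta>" using n_le xh by linarith
  finally show "24 * real n \<le> \<tau> * pattern_beta A D m" by (simp add: \<beta>_def)
  have Apow_le: "A powr (1 / L) \<le> exp 1"
  proof -
    have "1 * (1 * exp 1 * A powr (1 - 1 / L)) \<le> real n * (720\<^sup>2 * exp 1 * A powr (1 - 1 / L))"
      using n(1) by (intro mult_mono) auto
    also have "\<dots> \<le> exp L" using n_le xh expL by linarith
    finally have "A powr (1 - 1 / L) \<le> exp (L - 1)" by (simp add: exp_diff pos_le_divide_eq mult.commute)
    then have "exp ((1 - 1 / L) * ln A) \<le> exp (L - 1)" using A by (simp add: powr_def)
    then have le: "(1 - 1 / L) * ln A \<le> (1 - 1 / L) * L" using L by (simp add: algebra_simps)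
    show ?thesis
    proof (cases "L = 1")
      \<comment> \<open>With \<open>L = 1\<close> the inequality \<open>le\<close> says nothing
        about \<open>A\<close>; here the bound itself contradicts \<open>n \<ge> 1\<close>.\<close>
      case True
      have "real n * (720\<^sup>2 * exp 1) \<le> exp 1 * h" using n_le True expL A by simp
      also have "\<dots> \<le> exp 1 * 1" using h1 by (intro mult_left_mono) auto
      finally have "real n * 720\<^sup>2 \<le> 1" by (simp add: mult.assoc[symmetric] mult_le_cancel_right1)
      then show ?thesis using n(1) by simp
    next
      case False
      then have "1 - 1 / L > 0" using L by simp
      then have "ln A \<le> L" using le by (simp add: mult_le_cancel_left)
      then have "1 / L * ln A \<le> 1" using L by simp
      then show ?thesis using A by (simp add: powr_def)
    qed
  qed
  define \<sigma> where "\<sigma> = \<tau> / A"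
  have \<sigma>0: "\<sigma> > 0" using \<tau> A by (simp add: \<sigma>_def)
  \<comment> \<open>The factor \<open>exp 1\<close> in the bound pays for replacing
    \<open>A powr (1 - 1 / L)\<close> by \<open>A\<close>.\<close>
  have n_le': "real n * 720\<^sup>2 \<le> \<sigma> * \<beta> * h"
  proof -
    have "A powr (1 - 1 / L) * A powr (1 / L) = A" using A by (simp flip: powr_add)
    then have "A \<le> A powr (1 - 1 / L) * exp 1"
      using mult_left_mono[OF Apow_le, of "A powr (1 - 1 / L)"] by simp
    then have "real n * (720\<^sup>2 * A) \<le> real n * (720\<^sup>2 * (A powr (1 - 1 / L) * exp 1))"
      by (intro mult_left_mono) auto
    also have "\<dots> = real n * (720\<^sup>2 * exp 1 * A powr (1 - 1 / L))" by (simp only: mult_ac)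
    also note n_le
    finally show ?thesis using A by (simp add: \<sigma>_def field_simps)
  qed
  have \<sigma>_ge: "720\<^sup>2 \<le> \<sigma>"
  proof -
    have "1 * 720\<^sup>2 \<le> real n * 720\<^sup>2" using n(1) by (intro mult_right_mono) auto
    also have "\<dots> \<le> \<sigma> * \<beta> * h" by (rule n_le')
    also have "\<dots> \<le> \<sigma> * 1 * 1" using \<beta> h0 h1 \<sigma>0 by (intro mult_mono) auto
    finally show ?thesis by simp
  qed
  have ln_\<sigma>: "0 < ln \<sigma>" using \<sigma>_ge by simp
  have "ln \<sigma> \<le> ln \<tau>" using A \<tau> by (simp add: \<sigma>_def ln_div)
  also have "ln \<tau> = L + b" using \<beta>(1) \<tau> by (simp add: L_def b_def ln_mult)
  finally have ln_\<sigma>_le: "ln \<sigma> \<le> L + b" .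
  have n_ln: "real n * ln \<sigma> * 720\<^sup>2 \<le> 2 * \<sigma>"
  proof -
    have "h * (L + b) \<le> 2 * b"
    proof -
      have "h * L \<le> b" using hb L by (simp add: field_simps)
      moreover have "h * b \<le> 1 * b" using h1 b by (intro mult_right_mono) auto
      ultimately show ?thesis by (simp add: algebra_simps)
    qed
    moreover have "\<beta> * b \<le> 1"
      using exp_ge_add_one_self[of b]
      by (simp add: expb exp_minus divide_le_eq del: exp_ge_add_one_self flip: divide_inverse_commute)
    ultimately have hLb: "\<beta> * (h * (L + b)) \<le> 2"
      using mult_left_mono[of "h * (L + b)" "2 * b" \<beta>] \<beta>(1) by linarith
    have "real n * 720\<^sup>2 * ln \<sigma> \<le> (\<sigma> * \<beta> * h) * (L + b)"
      using ln_\<sigma> \<sigma>0 \<beta> h0 by (intro mult_mono[OF n_le' ln_\<sigma>_le]) auto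
    also have "\<dots> = \<sigma> * (\<beta> * (h * (L + b)))" by (simp only: mult_ac)
    also have "\<dots> \<le> \<sigma> * 2" using hLb \<sigma>0 by (intro mult_left_mono) auto
    finally show ?thesis by (simp add: mult_ac)
  qed
  obtain q where q: "2 ^ q \<le> \<sigma>" "\<sigma> < 2 * 2 ^ q"
    using exists_power_two_ivl[of \<sigma>] \<sigma>_ge by auto
  have "q \<ge> 2"
  proof (rule ccontr)
    assume "\<not> 2 \<le> q"
    then have "(2::real) ^ q \<le> 2 ^ 1" by (intro power_increasing) auto
    then show False using q \<sigma>_ge by simp
  qed
  \<comment> \<open>From \<open>ln 2 \<ge> 2 / 3\<close> comes
    \<open>q \<le> 3 / 2 * ln \<sigma>\<close>, so \<open>576 * n * q\<close> is at most
    \<open>1728 * \<sigma> / 720\<^sup>2\<close>, far below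
    \<open>2 ^ q > \<sigma> / 2\<close>.\<close>
  moreover have "576 * n * q \<le> 2 ^ q"
  proof -
    have "ln (2 ^ q) \<le> ln \<sigma>" using q \<sigma>0 by simp
    then have "real q * ln 2 \<le> ln \<sigma>" by (simp add: ln_realpow)
    moreover have "real q * (2 / 3) \<le> real q * ln 2"
      using ln2_ge_two_thirds by (intro mult_left_mono) auto
    ultimately have "real q \<le> 3 / 2 * ln \<sigma>" by simp
    then have "real n * real q \<le> real n * (3 / 2 * ln \<sigma>)" by (intro mult_left_mono) auto
    then have "576 * (real n * real q) \<le> 2 ^ q" using n_ln q by (simp add: power2_eq_square)
    then have "real (576 * n * q) \<le> real (2 ^ q)" by simp
    then show ?thesis by (simp only: of_nat_le_iff)
  qed
  ultimately show "\<exists>q. q \<ge> 2 \<and> 576 * n * q \<le> 2 ^ q \<and> 2 ^ q \<le> \<tau> / A"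
    using q by (auto simp: \<sigma>_def)
qed

text \<open>With \<open>x = \<tau> * \<beta>\<close>, \<open>A powr (1 - 1 / ln x)\<close> tends to
  \<open>A\<close> and \<open>1 - \<beta> powr (1 / ln x)\<close> behaves like
  \<open>- ln \<beta> / ln x\<close>. The floor costs at most 1, which is negligible against
  \<open>\<tau> / ln \<tau>\<close>.\<close>

lemma pattern_bound_asymp:
  assumes "A \<ge> 1" "D > 0" "m > 0"
  shows "((\<lambda>\<tau>. pattern_bound A D m \<tau> / (\<tau> / ln \<tau>)) \<longlongrightarrow>
    - ln (pattern_beta A D m) * pattern_beta A D m / (720\<^sup>2 * exp 1 * A)) at_top"
proof -
  define \<beta> where "\<beta> = pattern_beta A D m"
  note \<beta> = pattern_beta_bounds[OF assms(1-3), folded \<beta>_def]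
  define b where "b = - ln \<beta>"
  define c where "c = 720\<^sup>2 * exp (1::real)"
  have c: "c > 0" by (simp add: c_def)
  have b: "b > 0" using \<beta> by (simp add: b_def)
  have A: "A > 0" using assms by simp
  define f where "f \<tau> = \<tau> * \<beta> / (c * A powr (1 - 1 / ln (\<tau> * \<beta>))) * (1 - \<beta> powr (1 / ln (\<tau> * \<beta>)))" for \<tau>
  have f_eq: "f \<tau> = \<tau> * \<beta> / (c * exp ((1 - 1 / ln (\<tau> * \<beta>)) * ln A)) * (1 - exp (- b / ln (\<tau> * \<beta>)))" for \<tau>
    using A \<beta> by (simp add: f_def powr_def b_def)
  have lim: "((\<lambda>\<tau>. f \<tau> / (\<tau> / ln \<tau>)) \<longlongrightarrow> b * \<beta> / (c * exp (ln A))) at_top"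
    unfolding f_eq using \<beta>(1) b c by real_asymp (simp add: field_simps)
  have lim0: "((\<lambda>\<tau>. 1 / (\<tau> / ln \<tau>)) \<longlongrightarrow> 0) (at_top :: real filter)" by real_asymp
  have "((\<lambda>\<tau>. f \<tau> / (\<tau> / ln \<tau>) - 1 / (\<tau> / ln \<tau>)) \<longlongrightarrow> b * \<beta> / (c * exp (ln A)) - 0) at_top"
    by (intro tendsto_diff lim lim0)
  then have lim': "((\<lambda>\<tau>. (f \<tau> - 1) / (\<tau> / ln \<tau>)) \<longlongrightarrow> b * \<beta> / (c * exp (ln A))) at_top"
    by (simp only: diff_divide_distrib diff_zero)
  have pos: "eventually (\<lambda>\<tau>::real. 0 < \<tau> / ln \<tau>) at_top" by real_asymp
  have "((\<lambda>\<tau>. \<lfloor>f \<tau>\<rfloor> / (\<tau> / ln \<tau>)) \<longlongrightarrow> b * \<beta> / (c * exp (ln A))) at_top"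
  proof (rule tendsto_sandwich[OF _ _ lim' lim])
    show "eventually (\<lambda>\<tau>. (f \<tau> - 1) / (\<tau> / ln \<tau>) \<le> \<lfloor>f \<tau>\<rfloor> / (\<tau> / ln \<tau>)) at_top"
      using pos by eventually_elim (intro divide_right_mono; linarith)
    show "eventually (\<lambda>\<tau>. \<lfloor>f \<tau>\<rfloor> / (\<tau> / ln \<tau>) \<le> f \<tau> / (\<tau> / ln \<tau>)) at_top"
      using pos by eventually_elim (intro divide_right_mono; linarith)
  qed
  then show ?thesis
    using A by (simp add: pattern_bound_def Let_def f_def b_def c_def \<beta>_def)
qed

section \<open>Gaps of a thick set\<close>

text \<open>Order the elements by decreasing \<open>h\<close>, with ties broken by an injection into
  the naturals. Each element then has finitely many predecessors, and their number is an injective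
  rank.\<close>

lemma exists_decreasing_enumeration:
  fixes h :: "'a \<Rightarrow> real"
  assumes pos: "\<And>x. x \<in> A \<Longrightarrow> h x > 0" and fin: "\<And>e. e > 0 \<Longrightarrow> finite {x \<in> A. e \<le> h x}"
  shows "\<exists>K G. (K = UNIV \<or> (\<exists>k. K = {..<k :: nat})) \<and> bij_betw G K A \<and>
    (\<forall>i\<in>K. \<forall>j\<in>K. i \<le> j \<longrightarrow> h (G j) \<le> h (G i))"
proof -
  have "A \<subseteq> (\<Union>n. {x \<in> A. 1 / real (Suc n) \<le> h x})"
  proof
    fix x assume x: "x \<in> A"
    obtain n where "1 / real (Suc n) < h x" using pos[OF x] nat_approx_posE by blast
    then have "x \<in> {x \<in> A. 1 / real (Suc n) \<le> h x}" using x by simp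
    then show "x \<in> (\<Union>n. {x \<in> A. 1 / real (Suc n) \<le> h x})" by blast
  qed
  moreover have "countable (\<Union>n. {x \<in> A. 1 / real (Suc n) \<le> h x})"
    by (intro countable_UN countable_finite[OF fin]) simp_all
  ultimately have "countable A" by (rule countable_subset)
  then obtain g :: "'a \<Rightarrow> nat" where g: "inj_on g A" by (auto simp: countable_def)
  define before where "before x = {y \<in> A. h x < h y \<or> (h x = h y \<and> g y < g x)}" for x
  define rank where "rank x = card (before x)" for x
  have fin_before: "finite (before x)" if "x \<in> A" for x
    by (rule finite_subset[OF _ fin[OF pos[OF that]]]) (auto simp: before_def)
  have rank_less: "rank y < rank x" if "x \<in> A" "y \<in> before x" for x y
    unfolding rank_def using that
    by (intro psubset_card_mono fin_before) (auto simp: before_def)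
  have rank_inj: "inj_on rank A"
  proof (rule inj_onI, rule ccontr)
    fix x y assume *: "x \<in> A" "y \<in> A" "rank x = rank y" "x \<noteq> y"
    then have "g x \<noteq> g y" using g by (auto dest: inj_onD)
    then have "y \<in> before x \<or> x \<in> before y" using * by (auto simp: before_def)
    then show False using rank_less * by force
  qed
  have anti: "h y \<le> h x" if "x \<in> A" "y \<in> A" "rank x \<le> rank y" for x y
    using rank_less[of x y] that by (force simp: before_def)
  \<comment> \<open>Enumerating the ranks increasingly avoids proving that they form an initial
    segment.\<close>
  define N where "N = rank ` A"
  have bij_rank: "bij_betw (inv_into A rank) N A"
    unfolding N_def using rank_inj by (intro bij_betw_inv_into inj_on_imp_bij_betw)
  obtain K e where K: "K = UNIV \<or> (\<exists>k. K = {..<k :: nat})" and e: "bij_betw e K N"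
    and e_mono: "\<And>i j. i \<in> K \<Longrightarrow> j \<in> K \<Longrightarrow> i \<le> j \<Longrightarrow> e i \<le> e j"
  proof (cases "finite N")
    case True
    show thesis
    proof (rule that[of "{..<card N}" "enumerate N"])
      show "bij_betw (enumerate N) {..<card N} N" using True by (rule finite_bij_enumerate)
      fix i j assume "i \<in> {..<card N}" "j \<in> {..<card N}" "i \<le> j"
      then show "enumerate N i \<le> enumerate N j"
        using finite_enumerate_mono[of i j N] True by (cases "i = j") (auto intro: less_imp_le)
    qed auto
  next
    case False
    show thesis
      by (rule that[of UNIV "enumerate N"]) (use False in \<open>auto intro: bij_enumerate\<close>)
  qed
  show ?thesis
  proof (intro exI[of _ K] exI[of _ "inv_into A rank \<circ> e"] conjI ballI impI K)
    show "bij_betw (inv_into A rank \<circ> e) K A" using e bij_rank by (rule bij_betw_trans)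
    fix i j assume *: "i \<in> K" "j \<in> K" "i \<le> j"
    have "e i \<in> N" "e j \<in> N" using e * by (auto simp: bij_betw_def)
    then show "h ((inv_into A rank \<circ> e) j) \<le> h ((inv_into A rank \<circ> e) i)"
      using e_mono[OF *] by (intro anti) (auto simp: N_def inv_into_into f_inv_into_f)
  qed
qed

text \<open>The minimum and maximum of \<open>C\<close> span an interval that contains the
  hull.\<close>

lemma endpoints_of_hull:
  fixes C :: "real set"
  assumes "compact C" "convex hull C = {a..b}" "a \<le> b"
  shows "a \<in> C" "b \<in> C"
proof -
  have sub: "C \<subseteq> {a..b}" using hull_subset[of C convex] assms by simp
  have "C \<noteq> {}" using assms by auto
  then obtain x y where x: "x \<in> C" "\<And>z. z \<in> C \<Longrightarrow> x \<le> z" and y: "y \<in> C" "\<And>z. z \<in> C \<Longrightarrow> z \<le> y"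
    using compact_attains_inf[OF assms(1)] compact_attains_sup[OF assms(1)] by metis
  have "convex hull C \<subseteq> {x..y}" using x y by (intro hull_minimal) auto
  then have "x \<le> a" "b \<le> y" using assms by auto
  then show "a \<in> C" "b \<in> C" using sub x(1) y(1) by (metis antisym atLeastAtMost_iff subsetD)+
qed

lemma Icc_fmeasurable: "{u..v::real} \<in> fmeasurable lborel"
  by (rule fmeasurableI) (simp_all add: emeasure_lborel_Icc_eq)

text \<open>A nonmeasurable \<open>G\<close> has \<open>len\<close> 0 by convention, which lets the
  pieces of a gap parent be bounded without measurability arguments.\<close>

lemma len_le_of_subset: "G \<subseteq> {u..v} \<Longrightarrow> u \<le> v \<Longrightarrow> len G \<le> v - u"
proof (cases "G \<in> sets lborel")
  assume "G \<subseteq> {u..v}" "u \<le> v" "G \<in> sets lborel"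
  then have "len G \<le> len {u..v}" by (intro measure_mono_fmeasurable Icc_fmeasurable)
  then show ?thesis using \<open>u \<le> v\<close> by simp
qed (simp add: measure_notin_sets)

locale unit_hull =
  fixes C :: "real set"
  assumes compact: "compact C" and hull: "convex hull C = {0..1}"
begin

lemma gaps_eq: "gaps C = components ({0..1} - C)"
  by (simp add: gaps_def hull)

text \<open>The end points 0 and 1 belong to \<open>C\<close>, so the complement can be taken in an
  open interval; this makes the gaps open.\<close>

lemma gap_domain: "{0..1} - C = {0<..<1} - C"
  using endpoints_of_hull[OF compact hull] by (auto simp: less_le)

lemma gap_open: "G \<in> gaps C \<Longrightarrow> open G"
  unfolding gaps_eq gap_domain
  by (rule open_components[OF open_Diff[OF open_greaterThanLessThan compact_imp_closed[OF compact]]])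

lemma gap_subset: "G \<in> gaps C \<Longrightarrow> G \<subseteq> {0..1}"
  unfolding gaps_eq using in_components_subset by blast

lemma gap_nonempty: "G \<in> gaps C \<Longrightarrow> G \<noteq> {}"
  unfolding gaps_eq using in_components_nonempty by blast

lemma gap_connected: "G \<in> gaps C \<Longrightarrow> connected G"
  unfolding gaps_eq using in_components_connected by blast

lemma gaps_disjoint: "G \<in> gaps C \<Longrightarrow> H \<in> gaps C \<Longrightarrow> G \<noteq> H \<Longrightarrow> G \<inter> H = {}"
  unfolding gaps_eq using components_nonoverlap by blast

lemma Union_gaps: "\<Union>(gaps C) = {0..1} - C"
  unfolding gaps_eq by (rule Union_components)

lemma gap_fmeasurable: "G \<in> gaps C \<Longrightarrow> G \<in> fmeasurable lborel"
  by (rule fmeasurableI2[OF Icc_fmeasurable[of 0 1]]) (auto dest: gap_subset gap_open)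

lemma gap_len_pos:
  assumes "G \<in> gaps C"
  shows "0 < len G"
proof -
  obtain x e where "e > 0" "ball x e \<subseteq> G"
    using gap_open[OF assms] gap_nonempty[OF assms] by (meson ex_in_conv open_contains_ball)
  then have "{x - e / 2..x + e / 2} \<subseteq> G" by (force simp: dist_real_def subset_eq)
  then have "len {x - e / 2..x + e / 2} \<le> len G"
    by (intro measure_mono_fmeasurable gap_fmeasurable[OF assms]) auto
  then show ?thesis using \<open>e > 0\<close> by simp
qed

lemma gap_dist_le_len:
  assumes "G \<in> gaps C" "x \<in> G" "y \<in> G"
  shows "\<bar>x - y\<bar> \<le> len G"
proof -
  have *: "y - x \<le> len G" if "x \<in> G" "y \<in> G" "x \<le> y" for x y
  proof -
    have "{x..y} \<subseteq> G"
      using gap_connected[OF assms(1)] that(1,2) by (rule connected_contains_Icc)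
    then have "len {x..y} \<le> len G"
      by (intro measure_mono_fmeasurable gap_fmeasurable[OF assms(1)]) auto
    then show ?thesis using that by simp
  qed
  show ?thesis using *[OF assms(2,3)] *[OF assms(3,2)] by linarith
qed

text \<open>The gaps are disjoint subsets of an interval of length 1, so at most
  \<open>1 / e\<close> of them have length at least \<open>e\<close>.\<close>

lemma finite_long_gaps:
  assumes e: "e > 0"
  shows "finite {G \<in> gaps C. e \<le> len G}"
proof (rule ccontr)
  assume "infinite {G \<in> gaps C. e \<le> len G}"
  then obtain F where F: "F \<subseteq> {G \<in> gaps C. e \<le> len G}" "finite F" "card F = nat \<lceil>1 / e\<rceil> + 1"
    using infinite_arbitrarily_large by meson
  have "card F * e \<le> (\<Sum>G\<in>F. len G)" using F(1) by (intro sum_bounded_below) auto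
  also have "\<dots> = len (\<Union>G\<in>F. G)"
  proof (rule measure_finite_Union[symmetric, OF F(2)])
    show "(\<lambda>G. G) ` F \<subseteq> sets lborel" using F(1) gap_fmeasurable fmeasurableD by blast
    show "disjoint_family_on (\<lambda>G. G) F"
      unfolding disjoint_family_on_def using F(1) gaps_disjoint by blast
    show "emeasure lborel G \<noteq> \<infinity>" if "G \<in> F" for G
      using F(1) that gap_fmeasurable[of G] by (auto dest: fmeasurableD2)
  qed
  also have "\<dots> \<le> 1 - 0" using F(1) gap_subset by (intro len_le_of_subset) auto
  finally have "real (card F) \<le> 1 / e" using e by (simp add: field_simps)
  then show False using F(3) by linarith
qed

lemma exists_gap_enumeration: "\<exists>K G. gap_enumeration C K G"
  unfolding gap_enumeration_def using gap_len_pos finite_long_gaps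
  by (rule exists_decreasing_enumeration)

text \<open>Enumerations exist and \<open>C\<close> is no singleton, so \<open>thickness\<close> is
  computed along a genuine enumeration. All later estimates use that one, whatever order it gives to
  ties.\<close>

lemma thickness_cases: "\<exists>K G. gap_enumeration C K G \<and> thickness C = thickness_along C K G"
proof -
  define KG where "KG = (SOME KG. gap_enumeration C (fst KG) (snd KG))"
  have "gap_enumeration C (fst KG) (snd KG)"
    unfolding KG_def by (rule someI_ex) (use exists_gap_enumeration in auto)
  moreover have "\<nexists>x. C = {x}"
    using endpoints_of_hull[OF compact hull] by force
  then have "thickness C = thickness_along C (fst KG) (snd KG)"
    by (simp add: thickness_def KG_def[symmetric] split: prod.split)
  ultimately show ?thesis by blast
qed

text \<open>The description operator in \<open>gap_parent\<close> is justified: \<open>G n\<close>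
  is connected and avoids the earlier gaps, so exactly one component contains it.\<close>

lemma gap_parent:
  assumes "gap_enumeration C K G" "n \<in> K"
  shows "gap_parent C G n \<in> components ({0..1} - (\<Union>i<n. G i))" "G n \<subseteq> gap_parent C G n"
proof -
  have K: "i \<in> K" if "i < n" for i
    using assms that by (auto simp: gap_enumeration_def)
  have bij: "bij_betw G K (gaps C)" using assms by (simp add: gap_enumeration_def)
  then have gap: "G i \<in> gaps C" if "i \<in> K" for i using that by (auto simp: bij_betw_def)
  have "G n \<inter> G i = {}" if "i < n" for i
    using gaps_disjoint[OF gap[OF assms(2)] gap[OF K[OF that]]] bij K[OF that] assms(2) that
    by (auto simp: bij_betw_def dest: inj_onD)
  then have sub: "G n \<subseteq> {0..1} - (\<Union>i<n. G i)" using gap_subset[OF gap[OF assms(2)]] by blast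
  have ne: "G n \<noteq> {}" using gap_nonempty[OF gap[OF assms(2)]] .
  obtain I where I: "I \<in> components ({0..1} - (\<Union>i<n. G i))" "G n \<subseteq> I"
    using exists_component_superset[OF sub _ gap_connected[OF gap[OF assms(2)]]] ne sub by blast
  have "gap_parent C G n = I"
    unfolding gap_parent_def hull
  proof (rule the_equality)
    fix I' assume I': "I' \<in> components ({0..1} - (\<Union>i<n. G i)) \<and> G n \<subseteq> I'"
    then have "I' \<inter> I \<noteq> {}" using I ne by blast
    then show "I' = I" using I I' components_nonoverlap by blast
  qed (use I in auto)
  then show "gap_parent C G n \<in> components ({0..1} - (\<Union>i<n. G i))" "G n \<subseteq> gap_parent C G n"
    using I by auto
qed

section \<open>Metric consequences of thickness\<close>

lemma thickness_nonneg: "0 \<le> thickness C"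
proof -
  obtain K G where "thickness C = thickness_along C K G" using thickness_cases by blast
  then show ?thesis by (auto simp: thickness_along_def intro!: INF_greatest)
qed

text \<open>Any gap would contribute a real number to the infimum.\<close>

lemma thickness_infinite:
  assumes "thickness C = \<infinity>"
  shows "gaps C = {}"
proof (rule ccontr)
  assume "gaps C \<noteq> {}"
  obtain K G where KG: "gap_enumeration C K G" "thickness C = thickness_along C K G"
    using thickness_cases by blast
  then have "bij_betw G K (gaps C)" by (simp add: gap_enumeration_def)
  then obtain n where "n \<in> K" using \<open>gaps C \<noteq> {}\<close> by (auto simp: bij_betw_def)
  then have "thickness C \<le> ereal (min (len (left_piece C G n)) (len (right_piece C G n)) / len (G n))"
    unfolding KG(2) thickness_along_def by (rule INF_lower)
  then show False using assms by simp
qed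

lemma thickness_pieces:
  assumes "gap_enumeration C K G" "thickness C = thickness_along C K G" "thickness C = ereal \<tau>" "n \<in> K"
  shows "\<tau> * len (G n) \<le> len (left_piece C G n)" "\<tau> * len (G n) \<le> len (right_piece C G n)"
proof -
  have "G n \<in> gaps C" using assms by (auto simp: gap_enumeration_def bij_betw_def)
  then have "0 < len (G n)" by (rule gap_len_pos)
  moreover have "thickness C \<le> ereal (min (len (left_piece C G n)) (len (right_piece C G n)) / len (G n))"
    unfolding assms(2) thickness_along_def using assms(4) by (rule INF_lower)
  ultimately show "\<tau> * len (G n) \<le> len (left_piece C G n)" "\<tau> * len (G n) \<le> len (right_piece C G n)"
    using assms(3) by (simp_all add: pos_le_divide_eq)
qed

text \<open>The left piece fits into \<open>[0,1]\<close> and is at least \<open>\<tau>\<close>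
  times as long as the gap.\<close>

lemma thickness_gap_len:
  assumes "thickness C = ereal \<tau>" "G \<in> gaps C"
  shows "\<tau> * len G \<le> 1"
proof -
  obtain K E where KG: "gap_enumeration C K E" "thickness C = thickness_along C K E"
    using thickness_cases by blast
  then have "G \<in> E ` K" using assms(2) by (simp add: gap_enumeration_def bij_betw_def)
  then obtain n where n: "n \<in> K" "G = E n" by blast
  have "left_piece C E n \<subseteq> {0..1}"
    using gap_parent(1)[OF KG(1) n(1)] in_components_subset unfolding left_piece_def by blast
  then have "len (left_piece C E n) \<le> 1" using len_le_of_subset[of _ 0 1] by simp
  then show ?thesis using thickness_pieces(1)[OF KG assms(1) n(1)] n by simp
qed

text \<open>The parent of the gap that comes later in the enumeration avoids the earlier gap, so one of
  its two pieces separates them.\<close>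

lemma thickness_gap_dist:
  assumes \<tau>: "thickness C = ereal \<tau>" and GH: "G \<in> gaps C" "H \<in> gaps C" "G \<noteq> H"
    and x: "x \<in> G" and y: "y \<in> H"
  shows "\<tau> * min (len G) (len H) \<le> \<bar>x - y\<bar>"
proof -
  obtain K E where KG: "gap_enumeration C K E" "thickness C = thickness_along C K E"
    using thickness_cases by blast
  have \<tau>0: "0 \<le> \<tau>" using thickness_nonneg \<tau> by simp
  have *: "\<tau> * len (E n) \<le> \<bar>z - w\<bar>" if i: "i < n" and n: "n \<in> K" and w: "w \<in> E i" and z: "z \<in> E n" for i n z w
  proof -
    note I = gap_parent[OF KG(1) n]
    define I where "I = gap_parent C E n"
    have I_int: "v \<in> I" if "u \<in> I" "u' \<in> I" "u \<le> v" "v \<le> u'" for u u' v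
      using in_components_connected[OF I(1)] that unfolding I_def connected_iff_interval by blast
    have w_I: "w \<notin> I" using in_components_subset[OF I(1)] i w unfolding I_def by blast
    have z_I: "z \<in> I" using I(2) z by (auto simp: I_def)
    show ?thesis
    proof (cases "w \<le> z")
      case True
      have sub: "left_piece C E n \<subseteq> {w..z}"
      proof
        fix v assume "v \<in> left_piece C E n"
        then have v: "v \<in> I" "v < z" using z by (auto simp: left_piece_def I_def)
        \<comment> \<open>A point \<open>v\<close> of the left piece with \<open>v < w\<close> would
          force \<open>w\<close> into the interval \<open>I\<close>, since \<open>z\<close> lies on
          the other side.\<close>
        have "w \<le> v" using I_int[OF v(1) z_I, of w] w_I True by linarith
        then show "v \<in> {w..z}" using v by simp
      qed
      show ?thesis
        using len_le_of_subset[OF sub True] thickness_pieces(1)[OF KG \<tau> n] by linarith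
    next
      case False
      have sub: "right_piece C E n \<subseteq> {z..w}"
      proof
        fix v assume "v \<in> right_piece C E n"
        then have v: "v \<in> I" "z < v" using z by (auto simp: right_piece_def I_def)
        have "v \<le> w" using I_int[OF z_I v(1), of w] w_I False by linarith
        then show "v \<in> {z..w}" using v by simp
      qed
      show ?thesis
        using len_le_of_subset[OF sub] thickness_pieces(2)[OF KG \<tau> n] False by linarith
    qed
  qed
  have "G \<in> E ` K" "H \<in> E ` K" using KG GH by (simp_all add: gap_enumeration_def bij_betw_def)
  then obtain i j where ij: "i \<in> K" "j \<in> K" "G = E i" "H = E j" by blast
  have min_le: "\<tau> * min (len G) (len H) \<le> \<tau> * len G" "\<tau> * min (len G) (len H) \<le> \<tau> * len H"
    using \<tau>0 by (auto intro: mult_left_mono)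
  show ?thesis
  proof (cases i j rule: linorder_cases)
    case less
    then show ?thesis using *[OF less ij(2), of x y] x y ij min_le(2) by (simp add: abs_minus_commute)
  next
    case greater
    then show ?thesis using *[OF greater ij(1), of y x] x y ij min_le(1) by simp
  qed (use GH ij in simp)
qed

end

section \<open>Patterns in thick sets\<close>

text \<open>Preimages of gaps are obstacles of size \<open>len G / c1 f\<close>. \<open>E\<close>
  may be any superset of the points avoiding them, so that one statement serves all dimension claims
  of the theorem.\<close>

lemma hausdorff_dim_pattern_pos:
  fixes P :: "(real \<Rightarrow> real) set" and c1 c2 :: "(real \<Rightarrow> real) \<Rightarrow> real"
  assumes A: "A \<ge> 1" and D: "D > 0" and m: "m > 0"
    and lip: "\<And>f. f \<in> P \<Longrightarrow> bi_lipschitz f (c1 f) (c2 f)"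
    and ratio: "\<And>f. f \<in> P \<Longrightarrow> c2 f / c1 f \<le> A" and inv: "\<And>f. f \<in> P \<Longrightarrow> inverse (c1 f) \<le> D"
    and C: "compact C" "convex hull C = {0..1}"
    and bound: "within_bound A D m (thickness C) P"
    and range: "\<not> (1 < thickness C * ereal (pattern_beta A D m) \<and>
      thickness C * ereal (pattern_beta A D m) < ereal (exp 1))"
    and E: "{a..a + m} - (\<Union>f\<in>P. \<Union>G\<in>gaps C. f -` G) \<subseteq> E"
  shows "hausdorff_dim E > 0"
proof (cases "P = {} \<or> gaps C = {}")
  case True
  \<comment> \<open>Without obstacles, \<open>M = 4\<close> and \<open>q = 2\<close> is an
    admissible dummy choice.\<close>
  interpret obstacles "{} :: (real \<Rightarrow> real) set" "{} :: real set set" "\<lambda>f G. f -` G" "\<lambda>f. len" 4 2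
    by unfold_locales simp_all
  show ?thesis using True E m by (intro hausdorff_dim_pos[OF m, of 0 a]) auto
next
  case False
  interpret C: unit_hull C using C by unfold_locales
  obtain \<tau> where \<tau>: "thickness C = ereal \<tau>" "\<tau> \<ge> 0"
    using C.thickness_nonneg C.thickness_infinite False by (cases "thickness C") auto
  define \<beta> where "\<beta> = pattern_beta A D m"
  note \<beta> = pattern_beta_bounds[OF A D m, folded \<beta>_def]
  have fin: "finite P" and card: "int (card P) \<le> pattern_bound A D m \<tau>"
    using bound by (simp_all add: within_bound_def \<tau>)
  have n: "card P \<ge> 1" using fin False by (simp add: Suc_le_eq card_gt_0_iff)
  \<comment> \<open>A nonempty pattern rules out \<open>\<tau> * \<beta> \<le> 1\<close>, and
    \<open>range\<close> rules out values strictly between 1 and \<open>exp 1\<close>.\<close>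
  have "1 < \<tau> * \<beta>"
    using pattern_bound_nonpos[OF A D m \<tau>(2)] card n by (fastforce simp: \<beta>_def)
  then have big: "exp 1 \<le> \<tau> * \<beta>" using range by (simp add: \<tau> \<beta>_def)
  have \<tau>_pos: "\<tau> > 0" using \<open>1 < \<tau> * \<beta>\<close> \<tau>(2) by (cases "\<tau> = 0") auto
  note scale = pattern_bound_scale[OF A D m big[unfolded \<beta>_def] n card]
  obtain q where q: "q \<ge> 2" "576 * card P * q \<le> 2 ^ q" "2 ^ q \<le> \<tau> / A" using scale(2) by blast
  have c1: "c1 f > 0" and c2: "c2 f > 0" if "f \<in> P" for f
    using lip[OF that] by (auto simp: bi_lipschitz_def)
  interpret obstacles P "gaps C" "\<lambda>f G. f -` G" "\<lambda>f G. len G / c1 f" "2 ^ q" q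
  proof
    fix f G assume f: "f \<in> P" and G: "G \<in> gaps C"
    show "0 < len G / c1 f" using C.gap_len_pos[OF G] c1[OF f] by simp
    fix x y assume x: "x \<in> f -` G"
    {
      assume y: "y \<in> f -` G"
      have "c1 f * \<bar>x - y\<bar> \<le> \<bar>f x - f y\<bar>" using lip[OF f] by (simp add: bi_lipschitz_def)
      also have "\<dots> \<le> len G" using C.gap_dist_le_len[OF G] x y by simp
      finally show "\<bar>x - y\<bar> \<le> len G / c1 f" using c1[OF f] by (simp add: field_simps)
    }
    fix H assume H: "H \<in> gaps C" "G \<noteq> H" and y: "y \<in> f -` H"
    let ?l = "min (len G) (len H)"
    have l: "0 < ?l" using C.gap_len_pos G H by simp
    \<comment> \<open>Passing to preimages divides distances by at most \<open>c2 f\<close> and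
      sizes by \<open>c1 f\<close>; the quotient \<open>c2 f / c1 f\<close> costs the factor
      \<open>A\<close>.\<close>
    have "real (2 ^ q) * min (len G / c1 f) (len H / c1 f) = 2 ^ q * (?l / c1 f)"
      using c1[OF f] by (simp add: min_def divide_le_cancel)
    also have "\<dots> \<le> \<tau> / A * (?l / c1 f)"
      using q(3) l c1[OF f] by (intro mult_right_mono) auto
    also have "\<dots> = \<tau> * ?l / (A * c1 f)" by simp
    also have "\<dots> \<le> \<tau> * ?l / c2 f"
      using ratio[OF f] c1[OF f] c2[OF f] A l \<tau>_pos by (intro divide_left_mono) (auto simp: field_simps)
    also have "\<dots> \<le> \<bar>f x - f y\<bar> / c2 f"
      using C.thickness_gap_dist[OF \<tau>(1) G H] x y c2[OF f] by (intro divide_right_mono) auto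
    also have "\<dots> \<le> \<bar>x - y\<bar>"
      using lip[OF f] c2[OF f] by (simp add: bi_lipschitz_def field_simps)
    finally show "real (2 ^ q) * min (len G / c1 f) (len H / c1 f) \<le> \<bar>x - y\<bar>" .
  qed (use fin q in auto)
  show ?thesis
  proof (rule hausdorff_dim_pos[OF m _ _ _ E])
    \<comment> \<open>Gap lengths are at most \<open>1 / \<tau>\<close> and \<open>1 / c1 f\<close>
      is at most \<open>D\<close>, so \<open>D / \<tau>\<close> bounds all obstacle sizes;
      \<open>\<beta> \<le> m / D\<close> makes them small enough for the root to be good.\<close>
    show "0 \<le> D / \<tau>" using D \<tau>_pos by simp
    show "len G / c1 f \<le> D / \<tau>" if "f \<in> P" "G \<in> gaps C" for f G
    proof -
      have "len G * inverse (c1 f) \<le> (1 / \<tau>) * D"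
        using C.thickness_gap_len[OF \<tau>(1) that(2)] inv[OF that(1)] c1[OF that(1)] \<tau>_pos
        by (intro mult_mono) (auto simp: field_simps)
      then show ?thesis by (simp add: divide_inverse mult.commute)
    qed
    have "24 * real (card P) \<le> \<tau> * \<beta>" using scale(1) by (simp add: \<beta>_def)
    also have "\<dots> \<le> \<tau> * (m / D)" using \<beta>(3) \<tau>_pos by (intro mult_left_mono) auto
    finally show "real (24 * card P) * (D / \<tau>) \<le> m" using D \<tau>_pos by (simp add: field_simps)
  qed
qed

theorem theorem7:
  fixes A D m :: real
  assumes "A \<ge> 1" and "D > 0" and "m > 0"
  shows
    "(\<forall>(\<F> :: (real \<Rightarrow> real) set) (c1 :: (real \<Rightarrow> real) \<Rightarrow> real) (c2 :: (real \<Rightarrow> real) \<Rightarrow> real)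
        (I :: real set) (C :: real set) (S :: real set).
        (\<forall>f\<in>\<F>. bi_lipschitz f (c1 f) (c2 f) \<and> c2 f / c1 f \<le> A \<and> inverse (c1 f) \<le> D) \<and>
        (\<exists>a. I = {a..a + m}) \<and> I \<subseteq> (\<Inter>f\<in>\<F>. f -` {0..1}) \<and>
        compact C \<and> convex hull C = {0..1} \<and> S = {..<0} \<union> C \<union> {1<..}
        \<longrightarrow>
        (\<forall>f\<in>\<F>. S \<inter> f ` I \<subseteq> S \<inter> {0..1}) \<and> S \<inter> {0..1} \<subseteq> C \<and>
        (\<forall>\<F>0. \<F>0 \<subseteq> \<F> \<and> within_bound A D m (thickness C) \<F>0 \<and>
              \<not> (1 < thickness C * ereal (pattern_beta A D m) \<and>
                 thickness C * ereal (pattern_beta A D m) < ereal (exp 1))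
            \<longrightarrow>
            hausdorff_dim (I \<inter> (\<Inter>f\<in>\<F>0. f -` S)) > 0 \<and>
            contains_pattern C \<F>0 \<and>
            hausdorff_dim {t. \<forall>f\<in>\<F>0. f t \<in> C} > 0))
     \<and>
     (\<exists>K>0. \<forall>\<^sub>F \<tau> in at_top. real_of_int (pattern_bound A D m \<tau>) \<le> K * (\<tau> / ln \<tau>)) \<and>
     (\<exists>K>0. \<forall>\<^sub>F \<tau> in at_top. \<tau> / ln \<tau> \<le> K * real_of_int (pattern_bound A D m \<tau>))"
proof (intro conjI allI impI)
  fix \<F> :: "(real \<Rightarrow> real) set" and c1 c2 :: "(real \<Rightarrow> real) \<Rightarrow> real" and I C S :: "real set"
  assume H: "(\<forall>f\<in>\<F>. bi_lipschitz f (c1 f) (c2 f) \<and> c2 f / c1 f \<le> A \<and> inverse (c1 f) \<le> D) \<and>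
        (\<exists>a. I = {a..a + m}) \<and> I \<subseteq> (\<Inter>f\<in>\<F>. f -` {0..1}) \<and>
        compact C \<and> convex hull C = {0..1} \<and> S = {..<0} \<union> C \<union> {1<..}"
  then show "\<forall>f\<in>\<F>. S \<inter> f ` I \<subseteq> S \<inter> {0..1}" by blast
  show "S \<inter> {0..1} \<subseteq> C" using H by auto
  fix \<F>0
  assume F0: "\<F>0 \<subseteq> \<F> \<and> within_bound A D m (thickness C) \<F>0 \<and>
              \<not> (1 < thickness C * ereal (pattern_beta A D m) \<and>
                 thickness C * ereal (pattern_beta A D m) < ereal (exp 1))"
  obtain a where a: "I = {a..a + m}" using H by blast
  have C: "compact C" "convex hull C = {0..1}" and S: "C \<subseteq> S" using H by auto
  interpret C: unit_hull C using C by unfold_locales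
  \<comment> \<open>Both dimension claims concern supersets of the points of \<open>I\<close> that
    avoid all preimages of gaps.\<close>
  have pos: "hausdorff_dim E > 0" if "{a..a + m} - (\<Union>f\<in>\<F>0. \<Union>G\<in>gaps C. f -` G) \<subseteq> E" for E
    using H F0 that by (intro hausdorff_dim_pattern_pos[OF assms _ _ _ C, of \<F>0 c1 c2 a E]) auto
  \<comment> \<open>\<open>f\<close> maps \<open>I\<close> into \<open>[0,1]\<close>, and a point of
    \<open>[0,1]\<close> outside all gaps belongs to \<open>C\<close>.\<close>
  have in_C: "f t \<in> C" if "t \<in> {a..a + m} - (\<Union>f\<in>\<F>0. \<Union>G\<in>gaps C. f -` G)" "f \<in> \<F>0" for t f
  proof -
    have "f t \<in> {0..1}" using H F0 that unfolding a by blast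
    moreover have "f t \<notin> \<Union>(gaps C)" using that by blast
    ultimately show ?thesis unfolding C.Union_gaps by blast
  qed
  show "hausdorff_dim (I \<inter> (\<Inter>f\<in>\<F>0. f -` S)) > 0"
    using in_C S unfolding a by (intro pos) blast
  show dim: "hausdorff_dim {t. \<forall>f\<in>\<F>0. f t \<in> C} > 0"
    using in_C by (intro pos) blast
  show "contains_pattern C \<F>0"
    using hausdorff_dim_pos_nonempty[OF dim] by (auto simp: contains_pattern_def)
next
  \<comment> \<open>The limit \<open>l\<close> is positive because \<open>pattern_beta A D m\<close>
    lies strictly between 0 and 1, so \<open>2 * l\<close> and \<open>2 / l\<close> serve as
    comparability constants.\<close>
  define l where "l = - ln (pattern_beta A D m) * pattern_beta A D m / (720\<^sup>2 * exp 1 * A)"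
  note \<beta> = pattern_beta_bounds[OF assms]
  have lim: "((\<lambda>\<tau>. pattern_bound A D m \<tau> / (\<tau> / ln \<tau>)) \<longlongrightarrow> l) at_top"
    unfolding l_def by (rule pattern_bound_asymp[OF assms])
  have l: "l > 0" unfolding l_def using \<beta> assms by (intro divide_pos_pos mult_pos_pos) auto
  have pos: "eventually (\<lambda>\<tau>::real. 0 < \<tau> / ln \<tau>) at_top" by real_asymp
  show "\<exists>K>0. \<forall>\<^sub>F \<tau> in at_top. real_of_int (pattern_bound A D m \<tau>) \<le> K * (\<tau> / ln \<tau>)"
  proof (intro exI[of _ "2 * l"] conjI)
    have "eventually (\<lambda>\<tau>. pattern_bound A D m \<tau> / (\<tau> / ln \<tau>) < 2 * l) at_top"
      using lim l by (intro order_tendstoD) auto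
    then show "\<forall>\<^sub>F \<tau> in at_top. real_of_int (pattern_bound A D m \<tau>) \<le> 2 * l * (\<tau> / ln \<tau>)"
      using pos by eventually_elim (simp only: pos_divide_less_eq less_imp_le)
  qed (use l in simp)
  show "\<exists>K>0. \<forall>\<^sub>F \<tau> in at_top. \<tau> / ln \<tau> \<le> K * real_of_int (pattern_bound A D m \<tau>)"
  proof (intro exI[of _ "2 / l"] conjI)
    have "eventually (\<lambda>\<tau>. l / 2 < pattern_bound A D m \<tau> / (\<tau> / ln \<tau>)) at_top"
      using lim l by (intro order_tendstoD) auto
    then show "\<forall>\<^sub>F \<tau> in at_top. \<tau> / ln \<tau> \<le> 2 / l * real_of_int (pattern_bound A D m \<tau>)"
      using pos
    proof eventually_elim
      case (elim \<tau>)
      then have "l / 2 * (\<tau> / ln \<tau>) < pattern_bound A D m \<tau>" by (simp only: pos_less_divide_eq)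
      then show ?case using l by (simp add: pos_le_divide_eq mult.commute)
    qed
  qed (use l in simp)
qed

end
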